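(* Let $(K,|\cdot|)$ be a non-Archimedean nontrivially valued field, $k$ its residue field, $D$ its ring of integers, $\varepsilon\in(0,1]$, $r\in|K^*|=\{|x|:x\in K, x\neq 0\}$ and $n\ge2$. Let $R:=\mathbb{Z}$ (the prime ring of $K$) if $\operatorname{char}K\ne\operatorname{char}k$, and $R:=D$ otherwise. Then any sphere $S[x,r]$ in $K^n$ not containing $\mathbf 0$ is $\mathrm{SL}(n,R,\varepsilon)$-paradoxical using $4$ pieces if $\|x\|>r$, and using $5-(-1)^n$ pieces if $\|x\|<r$.
   Context: A non-Archimedean valuation on a field $K$ is a function $|\cdot|:K\to[0,\infty)$ with $|x|=0\iff x=0$, $|xy|=|x||y|$, $|x+y|\le\max\{|x|,|y|\}$; it is nontrivial if $|K^*|\ne\{1\}$. $D=\{x\in K:|x|\le1\}$ is the ring of integers, $\mathfrak m=\{x:|x|<1\}$ its maximal ideal, $k=D/\mathfrak m$ the residue field. If $\operatorname{char}K\neq\operatorname{char}k$ then $\operatorname{char}K=0$, and $\mathbb{Z}$ is regarded as a subring of $D$. $K^n$ carries the norm $\|x\|=\max_i|x_i|$, and $S[x,r]=\{y\in K^n:\|y-x\|=r\}$. For a subring $R\subseteq D$ containing $1$ and $\varepsilon\in(0,1]$, $\mathrm{SL}(n,R,\varepsilon)$ is the group of matrices $[a_{ij}]\in\mathrm{SL}(n,R)$ with $|a_{ii}-1|<\varepsilon$ for all $i$ and $|a_{ij}|<\varepsilon$ for all $i\neq j$; it acts on $K^n$ by matrix multiplication on column vectors. For a group $G$ acting on a set $X$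 and $A,B\subseteq X$, write $A\sim_{G,m}B$ if there are partitions $A=\bigsqcup_{i=1}^mA_i$, $B=\bigsqcup_{i=1}^mB_i$ into (possibly empty) subsets and $g_1,\dots,g_m\in G$ with $g_i(A_i)=B_i$. A nonempty set $E\subseteq X$ is $G$-paradoxical using $s$ pieces if $E=A\sqcup B$ with $A\sim_{G,m}E$ and $B\sim_{G,l}E$ for some $m,l\ge1$ with $m+l=s$. The axiom of choice is assumed. *)

theory Defs
  imports
    "HOL-Analysis.Analysis"
    "HOL-Algebra.QuotRing"
    "HOL-Algebra.Group_Action"
begin

subsection \<open>Non-Archimedean valued fields\<close>

definition nonarch_valuation :: "('a::field \<Rightarrow> real) \<Rightarrow> bool" where
  "nonarch_valuation v \<longleftrightarrow>
     (\<forall>x. 0 \<le> v x) \<and>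
     (\<forall>x. v x = 0 \<longleftrightarrow> x = 0) \<and>
     (\<forall>x y. v (x * y) = v x * v y) \<and>
     (\<forall>x y. v (x + y) \<le> max (v x) (v y))"

definition value_group :: "('a::field \<Rightarrow> real) \<Rightarrow> real set" where
  "value_group v = v ` (UNIV - {0})"

definition nontrivial_valuation :: "('a::field \<Rightarrow> real) \<Rightarrow> bool" where
  "nontrivial_valuation v \<longleftrightarrow> value_group v \<noteq> {1}"

definition valuation_ring :: "('a::field \<Rightarrow> real) \<Rightarrow> 'a set" where
  "valuation_ring v = {x. v x \<le> 1}"

definition valuation_ideal :: "('a::field \<Rightarrow> real) \<Rightarrow> 'a set" where
  "valuation_ideal v = {x. v x < 1}"

definition residue_field :: "('a::field \<Rightarrow> real) \<Rightarrow> 'a set ring" where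
  "residue_field v =
     \<lparr>carrier = valuation_ring v, mult = (*), one = 1, zero = 0, add = (+)\<rparr> Quot valuation_ideal v"

text \<open>Counterpart of \<^term>\<open>CHAR('a::semiring_1)\<close> for rings given as records: the nonnegative
  generator of the ideal of all \<^term>\<open>n\<close> with \<^term>\<open>n\<close> times the unit equal to zero,
  in particular \<^term>\<open>0::nat\<close> if no positive such \<^term>\<open>n\<close> exists.\<close>

definition ring_characteristic :: "('b, 'm) ring_scheme \<Rightarrow> nat" where
  "ring_characteristic R = Gcd {n::nat. [n] \<cdot>\<^bsub>R\<^esub> \<one>\<^bsub>R\<^esub> = \<zero>\<^bsub>R\<^esub>}"

text \<open>The ring of scalars: the prime ring (a copy of the integers) in mixed
  characteristic, and the ring of integers of the valuation in equal characteristic.\<close>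

definition scalar_ring :: "('a::field \<Rightarrow> real) \<Rightarrow> 'a set" where
  "scalar_ring v =
     (if CHAR('a) \<noteq> ring_characteristic (residue_field v) then range of_int
      else valuation_ring v)"

definition max_norm :: "('a::field \<Rightarrow> real) \<Rightarrow> 'a ^ 'n \<Rightarrow> real" where
  "max_norm v x = Max (range (\<lambda>i. v (x $ i)))"

definition vsphere :: "('a::field \<Rightarrow> real) \<Rightarrow> 'a ^ 'n \<Rightarrow> real \<Rightarrow> ('a ^ 'n) set" where
  "vsphere v x r = {y. max_norm v (y - x) = r}"

definition SL_eps :: "('a::field \<Rightarrow> real) \<Rightarrow> 'a set \<Rightarrow> real \<Rightarrow> ('a ^ 'n ^ 'n) monoid" where
  "SL_eps v R \<epsilon> =
     \<lparr>carrier = {A. (\<forall>i j. A $ i $ j \<in> R) \<and> det A = 1 \<and>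
                    (\<forall>i. v (A $ i $ i - 1) < \<epsilon>) \<and>
                    (\<forall>i j. i \<noteq> j \<longrightarrow> v (A $ i $ j) < \<epsilon>)},
      mult = (**), one = mat 1\<rparr>"

subsection \<open>Paradoxical sets\<close>

text \<open>As in \<^locale>\<open>group_action\<close>, the action is a map \<^term>\<open>\<phi>\<close> from group elements to
  self-maps of the set acted upon; here that set is the whole type \<open>'x\<close>.\<close>

definition equidecomposable ::
  "('g, 'm) monoid_scheme \<Rightarrow> ('g \<Rightarrow> 'x \<Rightarrow> 'x) \<Rightarrow> nat \<Rightarrow> 'x set \<Rightarrow> 'x set \<Rightarrow> bool" where
  "equidecomposable G \<phi> m A B \<longleftrightarrow>
     (\<exists>(P :: nat \<Rightarrow> 'x set) (Q :: nat \<Rightarrow> 'x set) (g :: nat \<Rightarrow> 'g).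
        disjoint_family_on P {..<m} \<and> (\<Union>i<m. P i) = A \<and>
        disjoint_family_on Q {..<m} \<and> (\<Union>i<m. Q i) = B \<and>
        (\<forall>i<m. g i \<in> carrier G \<and> \<phi> (g i) ` P i = Q i))"

definition paradoxical ::
  "('g, 'm) monoid_scheme \<Rightarrow> ('g \<Rightarrow> 'x \<Rightarrow> 'x) \<Rightarrow> 'x set \<Rightarrow> nat \<Rightarrow> bool" where
  "paradoxical G \<phi> E s \<longleftrightarrow>
     E \<noteq> {} \<and>
     (\<exists>A B m l. E = A \<union> B \<and> A \<inter> B = {} \<and> 1 \<le> m \<and> 1 \<le> l \<and> m + l = s \<and>
        equidecomposable G \<phi> m A E \<and> equidecomposable G \<phi> l B E)"

end

theory Submission
  imports Defs
begin

text \<open>The congruence group contains a free group of rank two no nontrivial element of which has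
  eigenvalue one. Indeed the scalars contain a subring \<open>P\<close> carrying a multiplicative size \<open>N\<close>
  (the absolute value on the integers in mixed characteristic, the exponential of the degree in
  polynomials in a transcendental \<open>s\<close> with prime field coefficients otherwise) for which some
  \<open>s\<close> is large, although its valuation is as small as we like. With respect to \<open>N\<close> two products of
  elementary matrices with parameters \<open>s\<close> and \<open>s\<^sup>2\<close> play ping-pong and are hyperbolic, so
  no nontrivial word in them fixes a nonzero vector of the plane. Letting them act diagonally on disjoint
  coordinate planes gives a free action on the points of the sphere with a nonzero coordinate in
  one of these planes, hence a paradox with four pieces. If \<open>\<parallel>x\<parallel> > r\<close>, one plane through a
  coordinate where \<open>x\<close> attains its norm suffices; if \<open>\<parallel>x\<parallel> < r\<close> and the dimension is even,
  the planes exhaust all coordinates; if the dimension is odd, the points on the remaining axis are absorbed at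
  the cost of two more pieces.\<close>

subsection \<open>Free actions of the free group of rank two\<close>

text \<open>A letter \<open>(g, e)\<close> stands for the generator \<open>g\<close> if \<open>e\<close> holds and for its inverse otherwise;
  the word \<open>w\<close> acts as \<^term>\<open>foldr act w\<close>.\<close>

definition inv_letter :: "bool \<times> bool \<Rightarrow> bool \<times> bool" where
  "inv_letter c = (fst c, \<not> snd c)"

lemma inv_letter_inv_letter [simp]: "inv_letter (inv_letter c) = c"
  by (simp add: inv_letter_def)

lemma inv_letter_neq [simp]: "inv_letter c \<noteq> c"
  by (cases c) (simp add: inv_letter_def)

abbreviation reduced :: "(bool \<times> bool) list \<Rightarrow> bool" where
  "reduced \<equiv> successively (\<lambda>c d. d \<noteq> inv_letter c)"

lemma snd_inv_letter [simp]: "snd (inv_letter c) \<longleftrightarrow> \<not> snd c"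
  by (simp add: inv_letter_def)

definition inv_word :: "(bool \<times> bool) list \<Rightarrow> (bool \<times> bool) list" where
  "inv_word w = map inv_letter (rev w)"

lemma inv_word_Nil [simp]: "inv_word [] = []"
  and inv_word_Cons [simp]: "inv_word (c # w) = inv_word w @ [inv_letter c]"
  by (simp_all add: inv_word_def)

lemma reduced_inv_word: "reduced (inv_word w) = reduced w"
proof -
  have "(\<lambda>c d. inv_letter c \<noteq> inv_letter (inv_letter d)) = (\<lambda>c d. d \<noteq> inv_letter c)"
    by (auto simp: fun_eq_iff)
  then show ?thesis
    unfolding inv_word_def successively_map successively_rev by (rule arg_cong)
qed

text \<open>Left multiplication by a letter in the free group, on reduced words: a single
  cancellation restores reducedness.\<close>

definition reduced_Cons :: "bool \<times> bool \<Rightarrow> (bool \<times> bool) list \<Rightarrow> (bool \<times> bool) list" where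
  "reduced_Cons c w = (if w \<noteq> [] \<and> hd w = inv_letter c then tl w else c # w)"

lemma reduced_reduced_Cons: "reduced w \<Longrightarrow> reduced (reduced_Cons c w)"
  by (cases w) (auto simp: reduced_Cons_def successively_Cons)

text \<open>A free action of the free group of rank two, expressed by letters and words alone. Since
  \<open>inv_letter\<close> is an involution, \<open>act_inv_letter\<close> makes every letter a
  bijection of \<open>X\<close>.\<close>

locale free_action =
  fixes X :: "'x set" and act :: "bool \<times> bool \<Rightarrow> 'x \<Rightarrow> 'x"
  assumes act_closed: "x \<in> X \<Longrightarrow> act c x \<in> X"
    and act_inv_letter: "x \<in> X \<Longrightarrow> act (inv_letter c) (act c x) = x"
    and no_fixed_point: "reduced w \<Longrightarrow> w \<noteq> [] \<Longrightarrow> x \<in> X \<Longrightarrow> foldr act w x \<noteq> x"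
begin

lemma foldr_act_closed: "x \<in> X \<Longrightarrow> foldr act w x \<in> X"
  by (induction w) (auto intro: act_closed)

lemma act_eq_iff: "x \<in> X \<Longrightarrow> y \<in> X \<Longrightarrow> act c x = act c y \<longleftrightarrow> x = y"
  by (metis act_inv_letter)

lemma act_letter_inv: "x \<in> X \<Longrightarrow> act c (act (inv_letter c) x) = x"
  by (metis act_inv_letter inv_letter_inv_letter)

lemma foldr_act_inv_word: "x \<in> X \<Longrightarrow> foldr act (inv_word w) (foldr act w x) = x"
  by (induction w) (simp_all add: act_inv_letter foldr_act_closed)

lemma foldr_act_reduced_Cons: "x \<in> X \<Longrightarrow> foldr act (reduced_Cons c w) x = act c (foldr act w x)"
  by (cases w) (auto simp: reduced_Cons_def act_letter_inv foldr_act_closed)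

text \<open>Common first letters cancel. If the first letters differ, the inverse of
  \<open>u\<close> followed by \<open>w\<close> is reduced and fixes \<open>x\<close>, against
  freeness.\<close>

lemma reduced_word_unique:
  assumes "reduced u" "reduced w" "x \<in> X" "foldr act u x = foldr act w x"
  shows "u = w"
  using assms
proof (induction u arbitrary: w)
  case Nil
  then show ?case
    using no_fixed_point[of w x] by auto
next
  case (Cons c u)
  show ?case
  proof (cases "w \<noteq> [] \<and> hd w = c")
    case True
    then obtain w' where w: "w = c # w'"
      by (cases w) auto
    have "reduced u" "reduced w'"
      using Cons.prems(1,2) w by (auto simp: successively_Cons)
    moreover have "foldr act u x = foldr act w' x"
      using Cons.prems(3,4) w by (simp add: act_eq_iff foldr_act_closed)
    ultimately show ?thesis
      using Cons.IH Cons.prems(3) w by blast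
  next
    case False
    have "reduced (inv_word (c # u))"
      using Cons.prems(1) reduced_inv_word by blast
    then have "reduced (inv_word (c # u) @ w)"
      unfolding successively_append_iff using False Cons.prems(2) by simp
    moreover have "foldr act (inv_word (c # u) @ w) x = x"
      by (simp only: foldr_append comp_apply Cons.prems(4)[symmetric] foldr_act_inv_word[OF Cons.prems(3)])
    ultimately have False
      using no_fixed_point[OF _ _ Cons.prems(3)] by (metis append_is_Nil_conv inv_word_Cons not_Cons_self2)
    then show ?thesis ..
  qed
qed

section \<open>Orbit representatives and word coordinates\<close>

definition orbit_of :: "'x \<Rightarrow> 'x set" where
  "orbit_of x = {y. \<exists>w. y = foldr act w x}"

text \<open>The choice depends on the orbit only as a set, so points with equal orbits get the same
  representative.\<close>

definition base_point :: "'x \<Rightarrow> 'x" where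
  "base_point x = (SOME y. y \<in> orbit_of x)"

text \<open>By freeness an orbit in \<open>X\<close> is a copy of the free group; this is the
  coordinate of \<open>x\<close> in that copy.\<close>

definition word_of :: "'x \<Rightarrow> (bool \<times> bool) list" where
  "word_of x = (THE w. reduced w \<and> foldr act w (base_point x) = x)"

lemma reduced_word_exists: "x \<in> X \<Longrightarrow> \<exists>u. reduced u \<and> foldr act u x = foldr act w x"
proof (induction w)
  case Nil
  show ?case by (rule exI[of _ "[]"]) simp
next
  case (Cons c w)
  then obtain u where "reduced u" "foldr act u x = foldr act w x"
    by blast
  then show ?case
    using Cons.prems
    by (intro exI[of _ "reduced_Cons c u"]) (simp add: reduced_reduced_Cons foldr_act_reduced_Cons)
qed

lemma base_point_in_orbit: "base_point x \<in> orbit_of x"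
proof -
  have "x \<in> orbit_of x"
    unfolding orbit_of_def by (auto intro: exI[of _ "[]"])
  then show ?thesis
    unfolding base_point_def by (rule someI)
qed

lemma base_point_closed: "x \<in> X \<Longrightarrow> base_point x \<in> X"
  using base_point_in_orbit[of x] by (auto simp: orbit_of_def foldr_act_closed)

lemma base_point_act:
  assumes "x \<in> X"
  shows "base_point (act c x) = base_point x"
proof -
  have "orbit_of (act c x) = orbit_of x"
  proof (intro equalityI subsetI)
    fix y assume "y \<in> orbit_of (act c x)"
    then obtain w where "y = foldr act (w @ [c]) x"
      by (auto simp: orbit_of_def)
    then show "y \<in> orbit_of x"
      unfolding orbit_of_def by blast
  next
    fix y assume "y \<in> orbit_of x"
    then obtain w where "y = foldr act w x"
      by (auto simp: orbit_of_def)
    then have "y = foldr act (w @ [inv_letter c]) (act c x)"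
      using assms by (simp add: act_inv_letter)
    then show "y \<in> orbit_of (act c x)"
      unfolding orbit_of_def by blast
  qed
  then show ?thesis
    by (simp add: base_point_def)
qed

lemma word_of_unique:
  assumes "x \<in> X" "reduced w" "foldr act w (base_point x) = x"
  shows "word_of x = w"
  unfolding word_of_def
  using assms reduced_word_unique[OF _ _ base_point_closed[OF assms(1)]] by (intro the_equality) auto

lemma word_of:
  assumes "x \<in> X"
  shows "reduced (word_of x)" "foldr act (word_of x) (base_point x) = x"
proof -
  obtain w where w: "base_point x = foldr act w x"
    using base_point_in_orbit[of x] by (auto simp: orbit_of_def)
  have "foldr act (inv_word w) (base_point x) = x"
    using assms w by (simp add: foldr_act_inv_word)
  then obtain u where "reduced u" "foldr act u (base_point x) = x"
    using reduced_word_exists[OF base_point_closed[OF assms], of "inv_word w"] by auto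
  then show "reduced (word_of x)" "foldr act (word_of x) (base_point x) = x"
    using word_of_unique[OF assms] by simp_all
qed

text \<open>A letter does not change the base point, so in coordinates the action is left
  multiplication. Decompositions of the free group thereby pull back to \<open>X\<close>.\<close>

lemma word_of_act: "x \<in> X \<Longrightarrow> word_of (act c x) = reduced_Cons c (word_of x)"
  by (intro word_of_unique)
     (simp_all add: act_closed word_of reduced_reduced_Cons base_point_act
       foldr_act_reduced_Cons base_point_closed)

lemma image_act_eqI:
  assumes "A \<subseteq> X" "B \<subseteq> X"
    and "\<And>x. x \<in> X \<Longrightarrow> act (inv_letter c) x \<in> A \<longleftrightarrow> x \<in> B"
  shows "act c ` A = B"
proof (intro equalityI subsetI)
  fix y assume "y \<in> act c ` A"
  then obtain x where "x \<in> A" "y = act c x" by blast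
  then show "y \<in> B"
    using assms(1) assms(3)[of y] by (auto simp: act_closed act_inv_letter)
next
  fix y assume "y \<in> B"
  then show "y \<in> act c ` A"
    using assms(2,3) by (metis act_letter_inv imageI subset_iff)
qed

text \<open>Words starting with \<open>a\<close>, \<open>a\<^sup>-\<^sup>1\<close>, \<open>b\<close>, \<open>b\<^sup>-\<^sup>1\<close> miss only the empty word; moving all
  powers of \<open>a\<^sup>-\<^sup>1\<close> into the first class absorbs it.\<close>

theorem four_piece_decomposition:
  obtains A1 A2 A3 A4 where
    "(A1 \<union> A2) \<union> (A3 \<union> A4) = X" "(A1 \<union> A2) \<inter> (A3 \<union> A4) = {}" "A1 \<inter> A2 = {}" "A3 \<inter> A4 = {}"
    "act (True, True) ` A2 = X - A1"
    "act (False, True) ` A4 = X - A3"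
proof
  define starts where "starts c = {x \<in> X. word_of x \<noteq> [] \<and> hd (word_of x) = c}" for c
  define pow where "pow = {x \<in> X. set (word_of x) \<subseteq> {(True, False)}}"
  let ?A1 = "starts (True, True) \<union> pow"
  let ?A2 = "starts (True, False) - pow"
  let ?A3 = "starts (False, True)"
  let ?A4 = "starts (False, False)"
  have pow: "pow \<inter> starts c = {}" if "c \<noteq> (True, False)" for c
  proof -
    have "x \<notin> starts c" if "x \<in> pow" for x
      using that \<open>c \<noteq> _\<close> by (cases "word_of x") (simp_all add: pow_def starts_def)
    then show ?thesis
      by blast
  qed
  have starts: "starts c \<inter> starts d = {}" if "c \<noteq> d" for c d
    using that by (auto simp: starts_def)
  \<comment> \<open>The new letter survives in front exactly when it cancels nothing. After a
    cancellation the tail cannot start with it, because the word was reduced.\<close>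
  have step: "x \<in> X \<Longrightarrow> act (g, False) x \<in> starts (g, False) \<longleftrightarrow> x \<notin> starts (g, True)" for g x
    using word_of(1)[of x]
    by (cases "word_of x")
       (auto simp: starts_def act_closed word_of_act reduced_Cons_def successively_Cons inv_letter_def)
  have "x \<in> (?A1 \<union> ?A2) \<union> (?A3 \<union> ?A4)" if "x \<in> X" for x
  proof (cases "word_of x")
    case Nil
    then show ?thesis
      using that by (simp add: pow_def)
  next
    case (Cons c w)
    then have "x \<in> starts c"
      using that by (simp add: starts_def)
    then show ?thesis
      by (cases c; cases "fst c"; cases "snd c") auto
  qed
  moreover have sub: "starts c \<subseteq> X" "pow \<subseteq> X" for c
    by (auto simp: starts_def pow_def)
  ultimately show "(?A1 \<union> ?A2) \<union> (?A3 \<union> ?A4) = X"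
    by blast
  show "(?A1 \<union> ?A2) \<inter> (?A3 \<union> ?A4) = {}" "?A1 \<inter> ?A2 = {}" "?A3 \<inter> ?A4 = {}"
    using pow[of "(False, True)"] pow[of "(False, False)"]
      starts[of "(True, True)" "(True, False)"] starts[of "(True, True)" "(False, True)"]
      starts[of "(True, True)" "(False, False)"] starts[of "(True, False)" "(False, True)"]
      starts[of "(True, False)" "(False, False)"] starts[of "(False, True)" "(False, False)"]
    by auto
  show "act (True, True) ` ?A2 = X - ?A1"
  proof (rule image_act_eqI)
    fix x assume x: "x \<in> X"
    \<comment> \<open>Without cancellation a letter is merely prepended, and prepending
      \<open>(True, False)\<close> neither creates nor destroys a power of it.\<close>
    have "act (True, False) x \<in> pow \<longleftrightarrow> x \<in> pow" if "x \<notin> starts (True, True)"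
    proof -
      have "word_of (act (True, False) x) = (True, False) # word_of x"
        using that x by (auto simp: starts_def word_of_act reduced_Cons_def inv_letter_def)
      then show ?thesis
        using x by (simp add: pow_def act_closed)
    qed
    then show "act (inv_letter (True, True)) x \<in> ?A2 \<longleftrightarrow> x \<in> X - ?A1"
      using step[OF x, of True] x by (simp add: inv_letter_def) blast
  qed (use sub in auto)
  show "act (False, True) ` ?A4 = X - ?A3"
  proof (rule image_act_eqI)
    fix x assume x: "x \<in> X"
    show "act (inv_letter (False, True)) x \<in> ?A4 \<longleftrightarrow> x \<in> X - ?A3"
      using step[OF x, of False] x by (simp add: inv_letter_def)
  qed (use sub in auto)
qed

end

subsection \<open>Two hyperbolic elements playing ping-pong\<close>

text \<open>The matrix with rows \<open>(1, t)\<close>, \<open>(0, 1)\<close> times its transpose, and the inverse of this product.\<close>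

definition shears :: "'k::field \<Rightarrow> 'k \<times> 'k \<Rightarrow> 'k \<times> 'k" where
  "shears t p = (let y = snd p + t * fst p in (fst p + t * y, y))"

definition inv_shears :: "'k::field \<Rightarrow> 'k \<times> 'k \<Rightarrow> 'k \<times> 'k" where
  "inv_shears t p = (let x = fst p - t * snd p in (x, snd p - t * x))"

text \<open>The parameters \<open>s\<close> and \<open>- s\<close> would not do for the two generators: they coincide in
  characteristic two.\<close>

definition letter_param :: "'k::field \<Rightarrow> bool \<times> bool \<Rightarrow> 'k" where
  "letter_param s c = (if fst c then s else s * s)"

definition pair_act :: "'k::field \<Rightarrow> bool \<times> bool \<Rightarrow> 'k \<times> 'k \<Rightarrow> 'k \<times> 'k" where
  "pair_act s c = (if snd c then shears else inv_shears) (letter_param s c)"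

lemma letter_param_inv_letter [simp]: "letter_param s (inv_letter c) = letter_param s c"
  by (simp add: letter_param_def inv_letter_def)

lemma pair_act_inv_letter: "pair_act s (inv_letter c) (pair_act s c p) = p"
  by (cases p) (simp add: pair_act_def shears_def inv_shears_def Let_def)

lemma foldr_pair_act_inv_word: "foldr (pair_act s) (inv_word w) (foldr (pair_act s) w p) = p"
  by (induction w) (simp_all add: pair_act_inv_letter)

text \<open>Only the ordinary triangle inequality is demanded of the size, because one instance is
  the usual absolute value on the integers. The bound 5 leaves room for the factor 2 in the cones
  below.\<close>

locale sized_subring =
  fixes P :: "'k::field set" and N :: "'k \<Rightarrow> real" and s :: 'k
  assumes zero_closed: "0 \<in> P" and one_closed: "1 \<in> P"
    and add_closed: "x \<in> P \<Longrightarrow> y \<in> P \<Longrightarrow> x + y \<in> P"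
    and mult_closed: "x \<in> P \<Longrightarrow> y \<in> P \<Longrightarrow> x * y \<in> P"
    and uminus_closed: "x \<in> P \<Longrightarrow> - x \<in> P"
    and size_nonneg: "x \<in> P \<Longrightarrow> 0 \<le> N x"
    and size_eq_0_iff: "x \<in> P \<Longrightarrow> N x = 0 \<longleftrightarrow> x = 0"
    and size_mult: "x \<in> P \<Longrightarrow> y \<in> P \<Longrightarrow> N (x * y) = N x * N y"
    and size_triangle: "x \<in> P \<Longrightarrow> y \<in> P \<Longrightarrow> N (x + y) \<le> N x + N y"
    and size_uminus: "x \<in> P \<Longrightarrow> N (- x) = N x"
    and base_closed: "s \<in> P" and base_size: "5 \<le> N s"
begin

lemma diff_closed: "x \<in> P \<Longrightarrow> y \<in> P \<Longrightarrow> x - y \<in> P"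
  using add_closed[of x "- y"] uminus_closed[of y] by simp

lemmas closed = zero_closed one_closed add_closed mult_closed uminus_closed diff_closed

lemma size_diff_triangle: "x \<in> P \<Longrightarrow> y \<in> P \<Longrightarrow> N (x - y) \<le> N x + N y"
  using size_triangle[of x "- y"] by (simp add: uminus_closed size_uminus)

lemma letter_param_closed: "letter_param s c \<in> P"
  by (simp add: letter_param_def base_closed mult_closed)

lemma letter_param_size: "5 \<le> N (letter_param s c)"
proof -
  have "5 * 1 \<le> N s * N s"
    using base_size by (intro mult_mono) auto
  then show ?thesis
    using base_size by (simp add: letter_param_def base_closed size_mult)
qed

section \<open>Cones and ping-pong dynamics\<close>

definition vectors :: "('k \<times> 'k) set" where
  "vectors = P \<times> P - {(0, 0)}"

definition vsize :: "'k \<times> 'k \<Rightarrow> real" where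
  "vsize p = max (N (fst p)) (N (snd p))"

text \<open>A neighbourhood of the line \<open>x = t y\<close>, respectively \<open>y = - t x\<close>, that attracts under the letter.\<close>

definition cone :: "bool \<times> bool \<Rightarrow> ('k \<times> 'k) set" where
  "cone c = {p. if snd c then N (fst p - letter_param s c * snd p) \<le> 2 * N (snd p)
                else N (snd p + letter_param s c * fst p) \<le> 2 * N (fst p)}"

text \<open>Put \<open>q = N (y + t * x)\<close>, so \<open>N x < q / 2\<close>. Then
  \<open>N y\<close> is at most \<open>(N t / 2 + 1) * q\<close>, while the new coordinate has size
  at least \<open>(N t - 1 / 2) * q\<close>, which is larger once \<open>N t > 3\<close>.\<close>

lemma expansion:
  assumes "x \<in> P" "y \<in> P" "t \<in> P" "5 \<le> N t" "2 * N x < N (y + t * x)"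
  shows "max (N x) (N y) < N (x + t * (y + t * x))"
proof -
  let ?q = "N (y + t * x)"
  have 1: "N y \<le> ?q + N t * N x"
    using size_diff_triangle[of "y + t * x" "t * x"] assms by (simp add: closed size_mult)
  have 2: "N t * ?q \<le> N (x + t * (y + t * x)) + N x"
    using size_diff_triangle[of "x + t * (y + t * x)" x] assms by (simp add: closed size_mult)
  have "0 \<le> N x"
    using assms by (simp add: size_nonneg)
  then have "5 * ?q \<le> N t * ?q" "N t * (2 * N x) \<le> N t * ?q"
    using assms by (auto intro!: mult_right_mono mult_left_mono)
  then show ?thesis
    unfolding max_less_iff_conj using 1 2 assms(5) \<open>0 \<le> N x\<close> by (intro conjI; linarith)
qed

lemma pair_act_closed: "p \<in> vectors \<Longrightarrow> pair_act s c p \<in> vectors"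
proof -
  assume p: "p \<in> vectors"
  have "pair_act s c p \<noteq> (0, 0)"
  proof
    assume "pair_act s c p = (0, 0)"
    then have "p = pair_act s (inv_letter c) (0, 0)"
      using pair_act_inv_letter[of s c p] by simp
    then show False
      using p by (auto simp: vectors_def pair_act_def shears_def inv_shears_def Let_def split: if_splits)
  qed
  then show ?thesis
    using p letter_param_closed[of c]
    by (auto simp: vectors_def pair_act_def shears_def inv_shears_def Let_def closed)
qed

text \<open>Avoiding the cone of the inverse letter is precisely the last hypothesis of
  \<open>expansion\<close>. The image lies in \<open>cone c\<close> because undoing the second shear
  gives back the old small coordinate. For an inverse letter the coordinates are exchanged and the
  parameter is negated.\<close>

lemma pair_act_ping_pong:
  assumes "p \<in> vectors" "p \<notin> cone (inv_letter c)"
  shows "pair_act s c p \<in> cone c" "vsize p < vsize (pair_act s c p)"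
proof -
  let ?t = "letter_param s c"
  obtain x y where p: "p = (x, y)" "x \<in> P" "y \<in> P"
    using assms(1) by (auto simp: vectors_def)
  have t: "?t \<in> P" "5 \<le> N ?t" "- ?t \<in> P" "5 \<le> N (- ?t)"
    using letter_param_closed[of c] letter_param_size[of c] by (auto simp: closed size_uminus)
  have "pair_act s c p \<in> cone c \<and> vsize p < vsize (pair_act s c p)"
  proof (cases "snd c")
    case True
    then have *: "2 * N x < N (y + ?t * x)"
      using assms(2) p by (simp add: cone_def)
    then show ?thesis
      using True p expansion[OF p(2,3) t(1,2) *] size_nonneg[OF p(2)]
      by (simp add: cone_def vsize_def pair_act_def shears_def Let_def less_max_iff_disj)
  next
    case False
    then have *: "2 * N y < N (x + - ?t * y)"
      using assms(2) p by (simp add: cone_def)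
    then show ?thesis
      using False p expansion[OF p(3,2) t(3,4) *] size_nonneg[OF p(3)]
      by (simp add: cone_def vsize_def pair_act_def inv_shears_def Let_def less_max_iff_disj)
  qed
  then show "pair_act s c p \<in> cone c" "vsize p < vsize (pair_act s c p)"
    by simp_all
qed

text \<open>For a positive letter, \<open>5 * N y \<le> N t * N y \<le> N x + 2 * N y\<close> forces
  \<open>x\<close> to be the larger coordinate; for a negative letter it is
  \<open>y\<close>.\<close>

lemma cone_dominates:
  assumes "p \<in> vectors" "p \<in> cone c"
  shows "if snd c then N (snd p) < N (fst p) else N (fst p) < N (snd p)"
proof -
  let ?t = "letter_param s c"
  obtain x y where p: "p = (x, y)" "x \<in> P" "y \<in> P" "(x, y) \<noteq> (0, 0)"
    using assms(1) by (auto simp: vectors_def)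
  have t: "?t \<in> P" "5 \<le> N ?t"
    using letter_param_closed[of c] letter_param_size[of c] by auto
  have nonneg: "0 \<le> N x" "0 \<le> N y"
    using p size_nonneg by auto
  have pos: "0 < N x \<or> 0 < N y"
    using p nonneg size_eq_0_iff[of x] size_eq_0_iff[of y] by auto
  have 1: "N ?t * N y \<le> N x + N (x - ?t * y)"
    using size_diff_triangle[of x "x - ?t * y"] p t by (simp add: closed size_mult)
  have 2: "N ?t * N x \<le> N y + N (y + ?t * x)"
    using size_diff_triangle[of "y + ?t * x" y] p t by (simp add: closed size_mult)
  have "5 * N y \<le> N ?t * N y" "5 * N x \<le> N ?t * N x"
    using t nonneg by (auto intro!: mult_right_mono)
  with 1 2 have "5 * N y \<le> N x + N (x - ?t * y)" "5 * N x \<le> N y + N (y + ?t * x)"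
    by linarith+
  then show ?thesis
    using assms(2) p(1) pos nonneg by (auto simp: cone_def)
qed

text \<open>Opposite signs are separated by the dominating coordinate. For equal signs the two cone
  conditions bound the size of \<open>s * s - s\<close> times the smaller coordinate by four times
  that coordinate, although \<open>s * s - s\<close> has size at least 20.\<close>

lemma cones_disjoint:
  assumes "p \<in> vectors" "p \<in> cone c" "p \<in> cone d"
  shows "c = d"
proof (rule ccontr)
  assume "c \<noteq> d"
  obtain x y where p: "p = (x, y)" "x \<in> P" "y \<in> P"
    using assms(1) by (auto simp: vectors_def)
  have snd: "snd c = snd d"
    using cone_dominates[OF assms(1,2)] cone_dominates[OF assms(1,3)] by (auto split: if_splits)
  with \<open>c \<noteq> d\<close> have fst: "fst c \<noteq> fst d"
    by (simp add: prod_eq_iff)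
  have large: "20 * N z \<le> N ((s * s - s) * z)" if "z \<in> P" for z
  proof -
    have "N s * N s \<le> N (s * s - s) + N s"
      using size_triangle[of "s * s - s" s] base_closed by (simp add: closed size_mult)
    moreover have "5 * N s \<le> N s * N s"
      using base_size by (intro mult_right_mono) auto
    ultimately have "20 \<le> N (s * s - s)"
      using base_size by linarith
    then show ?thesis
      using that base_closed by (simp add: closed size_mult size_nonneg mult_right_mono)
  qed
  show False
  proof (cases "snd c")
    case True
    have "N ((s * s - s) * y) \<le> N (x - s * y) + N (x - s * s * y)"
      using size_diff_triangle[of "x - s * y" "x - s * s * y"] p base_closed
      by (simp add: closed algebra_simps)
    also have "\<dots> \<le> 4 * N y"
      using assms(2,3) p(1) True snd fst by (auto simp: cone_def letter_param_def split: if_splits)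
    finally have "N y \<le> 0"
      using large[OF p(3)] by simp
    then have "N x \<le> 0"
      using assms(2) p True size_nonneg[OF p(3)] size_eq_0_iff[of y] by (auto simp: cone_def)
    then show False
      using cone_dominates[OF assms(1,2)] p True size_nonneg[OF p(3)] by simp
  next
    case False
    have "N ((s * s - s) * x) \<le> N (y + s * s * x) + N (y + s * x)"
      using size_diff_triangle[of "y + s * s * x" "y + s * x"] p base_closed
      by (simp add: closed algebra_simps)
    also have "\<dots> \<le> 4 * N x"
      using assms(2,3) p(1) False snd fst by (auto simp: cone_def letter_param_def split: if_splits)
    finally have "N x \<le> 0"
      using large[OF p(2)] by simp
    then have "N y \<le> 0"
      using assms(2) p False size_nonneg[OF p(2)] size_eq_0_iff[of x] by (auto simp: cone_def)
    then show False
      using cone_dominates[OF assms(1,2)] p False size_nonneg[OF p(2)] by simp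
  qed
qed

section \<open>Fixed vectors of reduced words\<close>

lemma foldr_pair_act_closed: "p \<in> vectors \<Longrightarrow> foldr (pair_act s) w p \<in> vectors"
  by (induction w) (auto intro: pair_act_closed)

text \<open>\<open>foldr\<close> applies the last letter first, so \<open>last w\<close> governs the
  start and \<open>hd w\<close> the end. Reducedness and disjointness of the cones keep each
  intermediate vector out of the cone that the next letter must avoid.\<close>

lemma reduced_word_ping_pong:
  assumes "reduced w" "w \<noteq> []" "p \<in> vectors" "p \<notin> cone (inv_letter (last w))"
  shows "foldr (pair_act s) w p \<in> cone (hd w) \<and> vsize p < vsize (foldr (pair_act s) w p)"
  using assms
proof (induction w)
  case (Cons c w)
  show ?case
  proof (cases "w = []")
    case True
    then show ?thesis
      using Cons.prems pair_act_ping_pong by simp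
  next
    case False
    let ?q = "foldr (pair_act s) w p"
    have IH: "?q \<in> cone (hd w)" "vsize p < vsize ?q"
      using Cons False by (auto simp: successively_Cons)
    have q: "?q \<in> vectors"
      using Cons.prems foldr_pair_act_closed by simp
    have "?q \<notin> cone (inv_letter c)"
      using cones_disjoint[OF q IH(1), of "inv_letter c"] Cons.prems(1) False
      by (auto simp: successively_Cons)
    then show ?thesis
      using pair_act_ping_pong[OF q] IH(2) by fastforce
  qed
qed simp

text \<open>A fixed vector cannot grow under \<open>w\<close>, so it lies in
  \<open>cone (inv_letter (last w))\<close>. As \<open>w\<close> is cyclically reduced, this is not
  \<open>cone (hd w)\<close>, so the vector grows under the inverse word, which fixes it
  too.\<close>

lemma cyclically_reduced_word_moves:
  assumes "reduced w" "w \<noteq> []" "hd w \<noteq> inv_letter (last w)" "p \<in> vectors"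
  shows "foldr (pair_act s) w p \<noteq> p"
proof
  assume fixed: "foldr (pair_act s) w p = p"
  then have inv: "foldr (pair_act s) (inv_word w) p = p"
    using foldr_pair_act_inv_word[of s w p] by simp
  have in_cone: "p \<in> cone (inv_letter (last w))"
    using reduced_word_ping_pong[OF assms(1,2,4)] fixed by auto
  have "last (inv_word w) = inv_letter (hd w)" "inv_word w \<noteq> []"
    using assms(2) by (simp_all add: inv_word_def last_map last_rev)
  moreover have "p \<notin> cone (hd w)"
    using cones_disjoint[OF assms(4) in_cone, of "hd w"] assms(3) by auto
  ultimately show False
    using reduced_word_ping_pong[of "inv_word w" p] assms(1,4) inv reduced_inv_word[of w] by auto
qed

text \<open>A fixed point of a conjugate \<open>c u c\<^sup>-\<^sup>1\<close> yields one of \<open>u\<close>.\<close>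

lemma reduced_word_moves:
  assumes "reduced w" "w \<noteq> []" "p \<in> vectors"
  shows "foldr (pair_act s) w p \<noteq> p"
  using assms
proof (induction "length w" arbitrary: w p rule: less_induct)
  case less
  show ?case
  proof (cases "hd w = inv_letter (last w)")
    case False
    then show ?thesis
      using cyclically_reduced_word_moves less.prems by blast
  next
    case True
    obtain c v where w: "w = c # v"
      using less.prems(2) by (cases w) auto
    with True have "v \<noteq> []"
      by (metis inv_letter_neq last.simps list.sel(1))
    then obtain u where v: "v = u @ [inv_letter c]"
      using True w by (metis append_butlast_last_id inv_letter_inv_letter last_ConsR list.sel(1))
    have u: "reduced u" "u \<noteq> []"
      using less.prems(1) unfolding w v by (auto simp: successively_Cons successively_append_iff)
    show ?thesis
    proof
      let ?q = "pair_act s (inv_letter c) p"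
      assume "foldr (pair_act s) w p = p"
      then have "pair_act s c (foldr (pair_act s) u ?q) = p"
        by (simp add: w v)
      then have "foldr (pair_act s) u ?q = ?q"
        by (metis pair_act_inv_letter)
      then show False
        using less.hyps[of u ?q] u pair_act_closed[OF less.prems(3)] by (simp add: w v)
    qed
  qed
qed

text \<open>Linearity transfers statements between vectors over \<open>P\<close> and vectors over
  the whole field, where the size says nothing.\<close>

lemma foldr_pair_act_linear:
  "\<exists>a\<in>P. \<exists>b\<in>P. \<exists>c\<in>P. \<exists>d\<in>P. \<forall>x y.
     foldr (pair_act s) w (x, y) = (a * x + b * y, c * x + d * y)"
proof (induction w)
  case Nil
  show ?case
    by (intro bexI[of _ 1] bexI[of _ 0]) (simp_all add: closed)
next
  case (Cons l w)
  then obtain a b c d where IH: "a \<in> P" "b \<in> P" "c \<in> P" "d \<in> P"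
      "\<And>x y. foldr (pair_act s) w (x, y) = (a * x + b * y, c * x + d * y)"
    by blast
  let ?t = "letter_param s l"
  have t: "?t \<in> P"
    by (rule letter_param_closed)
  show ?case
  proof (cases "snd l")
    case True
    then have step: "pair_act s l (x, y) = (x + ?t * (y + ?t * x), y + ?t * x)" for x y
      by (simp add: pair_act_def shears_def Let_def)
    show ?thesis
      by (rule bexI[of _ "a + ?t * (c + ?t * a)"], rule bexI[of _ "b + ?t * (d + ?t * b)"],
          rule bexI[of _ "c + ?t * a"], rule bexI[of _ "d + ?t * b"])
         (use IH t in \<open>auto simp: step closed algebra_simps\<close>)
  next
    case False
    then have step: "pair_act s l (x, y) = (x - ?t * y, y - ?t * (x - ?t * y))" for x y
      by (simp add: pair_act_def inv_shears_def Let_def)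
    show ?thesis
      by (rule bexI[of _ "a - ?t * c"], rule bexI[of _ "b - ?t * d"],
          rule bexI[of _ "c - ?t * (a - ?t * c)"], rule bexI[of _ "d - ?t * (b - ?t * d)"])
         (use IH t in \<open>auto simp: step closed algebra_simps\<close>)
  qed
qed

text \<open>The size is available on \<^term>\<open>P\<close> only, but if a matrix over \<^term>\<open>P\<close> fixes a nonzero
  vector, then the rows of its difference with the identity provide a fixed vector over \<^term>\<open>P\<close>.\<close>

theorem reduced_word_fixes_only_zero:
  assumes "reduced w" "w \<noteq> []" "foldr (pair_act s) w p = p"
  shows "p = (0, 0)"
proof (rule ccontr)
  assume p0: "p \<noteq> (0, 0)"
  obtain x y where p: "p = (x, y)"
    by (cases p)
  obtain a b c d where abcd: "a \<in> P" "b \<in> P" "c \<in> P" "d \<in> P"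
      and lin: "\<And>x y. foldr (pair_act s) w (x, y) = (a * x + b * y, c * x + d * y)"
    using foldr_pair_act_linear by blast
  have moves: "(a * x + b * y, c * x + d * y) \<noteq> (x, y)" if "x \<in> P" "y \<in> P" "(x, y) \<noteq> (0, 0)" for x y
    using reduced_word_moves[OF assms(1,2), of "(x, y)"] that lin by (simp add: vectors_def)
  have eq: "(a - 1) * x = - b * y" "c * x = (1 - d) * y"
    using assms(3) p lin by (auto simp: algebra_simps)
  \<comment> \<open>The word minus the identity kills the nonzero vector \<open>(x, y)\<close>, so
    its determinant vanishes.\<close>
  have det: "(a - 1) * (d - 1) = b * c"
  proof (cases "x = 0")
    case True
    then show ?thesis
      using eq p0 p by auto
  next
    case False
    have "((a - 1) * (d - 1)) * x = (b * c) * x"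
      using eq by (metis (no_types, opaque_lifting) minus_diff_eq minus_mult_left minus_mult_right mult.assoc mult.commute)
    with False show ?thesis
      by simp
  qed
  show False
  proof (cases "a = 1 \<and> b = 0")
    case True
    show False
    proof (cases "c = 0 \<and> d = 1")
      case True
      then show False
        using \<open>a = 1 \<and> b = 0\<close> moves[of 1 0] by (simp add: closed)
    next
      case False
      then show False
        using \<open>a = 1 \<and> b = 0\<close> moves[of "1 - d" c] abcd by (auto simp: closed algebra_simps)
    qed
  next
    case False
    \<comment> \<open>The vector \<open>(b, 1 - a)\<close> is killed by the first row of the
      difference, and by the second row because of \<open>det\<close>.\<close>
    then show False
      using moves[of b "1 - a"] abcd det by (auto simp: closed algebra_simps)
  qed
qed

text \<open>Serves to move an axis off itself by all positive powers of one generator. The vector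
  \<open>(0, 1)\<close> avoids the cone of the inverse letter, so its images lie in the cone where
  the first coordinate dominates; linearity extends this to every \<open>u\<close>.\<close>

lemma shears_power_moves_axis:
  assumes "0 < k" "fst ((pair_act s (True, True) ^^ k) (0, u)) = 0"
  shows "u = 0"
proof -
  let ?w = "replicate k (True, True)"
  let ?p = "foldr (pair_act s) ?w (0, 1)"
  have red: "reduced ?w"
  proof (induction k)
    case (Suc k)
    then show ?case
      by (cases k) (auto simp: inv_letter_def)
  qed simp
  have vec: "(0, 1) \<in> vectors"
    by (simp add: vectors_def closed)
  have "(0, 1) \<notin> cone (inv_letter (last ?w))"
    using assms(1) size_eq_0_iff[OF zero_closed] size_eq_0_iff[OF one_closed] size_nonneg[OF one_closed]
    by (auto simp: cone_def inv_letter_def)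
  then have "?p \<in> cone (True, True)"
    using reduced_word_ping_pong[OF red _ vec] assms(1) by simp
  then have "N (snd ?p) < N (fst ?p)"
    using cone_dominates[OF foldr_pair_act_closed[OF vec]] by fastforce
  moreover have "0 \<le> N (snd ?p)"
    using foldr_pair_act_closed[OF vec, of ?w] size_nonneg by (auto simp: vectors_def mem_Times_iff)
  ultimately have "fst ?p \<noteq> 0"
    using size_eq_0_iff[OF zero_closed] by auto
  moreover obtain a b c d where lin: "\<And>x y. foldr (pair_act s) ?w (x, y) = (a * x + b * y, c * x + d * y)"
    using foldr_pair_act_linear[of ?w] by blast
  ultimately show ?thesis
    using assms(2) by (simp add: lin flip: foldr_replicate)
qed

end

subsection \<open>Small scalars of large size\<close>

locale nonarch_field =
  fixes v :: "'k::field \<Rightarrow> real"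
  assumes valuation: "nonarch_valuation v"
begin

section \<open>Arithmetic of the valuation\<close>

lemma val_nonneg [simp]: "0 \<le> v x"
  and val_eq_0_iff [simp]: "v x = 0 \<longleftrightarrow> x = 0"
  and val_mult: "v (x * y) = v x * v y"
  and val_add: "v (x + y) \<le> max (v x) (v y)"
  using valuation by (auto simp: nonarch_valuation_def)

lemma val_0 [simp]: "v 0 = 0"
  by simp

lemma val_1 [simp]: "v 1 = 1"
proof -
  have "v 1 * v 1 = v 1"
    by (simp flip: val_mult)
  then show ?thesis
    by simp
qed

lemma val_uminus [simp]: "v (- x) = v x"
proof -
  have "v (- 1) * v (- 1) = 1"
    by (simp flip: val_mult)
  then have "v (- 1) = 1"
    using val_nonneg[of "- 1"] by (metis abs_of_nonneg abs_square_eq_1 power2_eq_square)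
  then show ?thesis
    using val_mult[of "- 1" x] by simp
qed

lemma val_minus_commute: "v (x - y) = v (y - x)"
  using val_uminus[of "x - y"] by simp

lemma val_diff: "v (x - y) \<le> max (v x) (v y)"
  using val_add[of x "- y"] by simp

lemma val_power: "v (x ^ n) = v x ^ n"
  by (induction n) (simp_all add: val_mult)

lemma val_inverse: "v (inverse x) = inverse (v x)"
proof (cases "x = 0")
  case False
  then have "v x * v (inverse x) = 1"
    by (simp flip: val_mult)
  then show ?thesis
    by (simp add: inverse_unique)
qed simp

lemma val_add_eq: "v y < v x \<Longrightarrow> v (x + y) = v x"
  using val_add[of x y] val_diff[of "x + y" y] by simp

lemma val_add_less: "v x < c \<Longrightarrow> v y < c \<Longrightarrow> v (x + y) < c"
  using val_add[of x y] by simp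

lemma val_sum_less:
  assumes "finite A" "0 < c" "\<And>i. i \<in> A \<Longrightarrow> v (f i) < c"
  shows "v (sum f A) < c"
  using assms
proof (induction A rule: finite_induct)
  case (insert i A)
  then show ?case
    by (simp add: val_add_less)
qed simp

lemma val_of_nat: "v (of_nat n) \<le> 1"
proof (induction n)
  case (Suc n)
  then show ?case
    using val_add[of 1 "of_nat n"] by simp
qed simp

lemma val_of_int: "v (of_int z) \<le> 1"
  by (cases z rule: int_cases2) (simp_all add: val_of_nat)

section \<open>Characteristics of the field and of its residue field\<close>

lemma residue_field_add_pow:
  "[n] \<cdot>\<^bsub>residue_field v\<^esub> \<one>\<^bsub>residue_field v\<^esub> = {y. v (y - of_nat n) < 1}"
proof (induction n)
  case 0
  show ?case
    by (simp add: residue_field_def FactRing_def add_pow_def nat_pow_def valuation_ideal_def)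
next
  case (Suc n)
  let ?R = "\<lparr>carrier = valuation_ring v, mult = (*), one = 1, zero = 0, add = (+)\<rparr>"
  have "[Suc n] \<cdot>\<^bsub>residue_field v\<^esub> \<one>\<^bsub>residue_field v\<^esub> =
      set_add ?R ([n] \<cdot>\<^bsub>residue_field v\<^esub> \<one>\<^bsub>residue_field v\<^esub>)
        (a_r_coset ?R (valuation_ideal v) 1)"
    by (simp add: residue_field_def FactRing_def add_pow_def nat_pow_def)
  also have "a_r_coset ?R (valuation_ideal v) 1 = {y. v (y - 1) < 1}"
  proof -
    have "y \<in> (\<Union>h\<in>{x. v x < 1}. {h + 1})" if "v (y - 1) < 1" for y
      using that by (intro UN_I[of "y - 1"]) simp_all
    then show ?thesis
      by (auto simp: a_r_coset_def r_coset_def valuation_ideal_def)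
  qed
  also have "set_add ?R ([n] \<cdot>\<^bsub>residue_field v\<^esub> \<one>\<^bsub>residue_field v\<^esub>) {y. v (y - 1) < 1} =
      {y. v (y - of_nat (Suc n)) < 1}"
    unfolding Suc
  proof (intro equalityI subsetI)
    fix z assume "z \<in> set_add ?R {y. v (y - of_nat n) < 1} {y. v (y - 1) < 1}"
    then obtain x y where "z = x + y" "v (x - of_nat n) < 1" "v (y - 1) < 1"
      by (auto simp: set_add_def set_mult_def)
    then show "z \<in> {y. v (y - of_nat (Suc n)) < 1}"
      using val_add[of "x - of_nat n" "y - 1"] by (simp add: algebra_simps)
  next
    fix z assume "z \<in> {y. v (y - of_nat (Suc n)) < 1}"
    then have "v (z - 1 - of_nat n) < 1"
      by (simp add: algebra_simps)
    then show "z \<in> set_add ?R {y. v (y - of_nat n) < 1} {y. v (y - 1) < 1}"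
      unfolding set_add_def set_mult_def by (auto intro!: bexI[of _ "z - 1"] bexI[of _ 1])
  qed
  finally show ?case .
qed

text \<open>The multiple of the unit by \<open>n\<close> is the coset of \<open>of_nat n\<close>,
  which is the zero coset exactly when \<open>of_nat n\<close> lies in the maximal ideal.\<close>

lemma ring_characteristic_residue_field:
  "ring_characteristic (residue_field v) = Gcd {n. v (of_nat n) < 1}"
proof -
  have "{y. v (y - of_nat n) < 1} = {y. v y < 1} \<longleftrightarrow> v (of_nat n) < 1" for n
  proof
    assume eq: "{y. v (y - of_nat n) < 1} = {y. v y < 1}"
    have "of_nat n \<in> {y. v (y - of_nat n) < 1}"
      by simp
    then show "v (of_nat n) < 1"
      unfolding eq by simp
  next
    assume n: "v (of_nat n) < 1"
    have "v (y - of_nat n) < 1 \<longleftrightarrow> v y < 1" for y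
      using val_diff[of y "of_nat n"] val_add[of "y - of_nat n" "of_nat n"] n by auto
    then show "{y. v (y - of_nat n) < 1} = {y. v y < 1}"
      by simp
  qed
  moreover have "\<zero>\<^bsub>residue_field v\<^esub> = {y. v y < 1}"
    by (simp add: residue_field_def FactRing_def valuation_ideal_def)
  ultimately show ?thesis
    by (simp add: ring_characteristic_def residue_field_add_pow)
qed

text \<open>An integer of valuation below one is divisible by the residue characteristic, hence zero
  in the field when the characteristics agree.\<close>

lemma val_of_int_equal_characteristic:
  assumes "CHAR('k) = ring_characteristic (residue_field v)" "of_int z \<noteq> (0::'k)"
  shows "v (of_int z) = 1"
proof (rule ccontr)
  assume "v (of_int z) \<noteq> 1"
  moreover have "v (of_int z) = v (of_nat (nat \<bar>z\<bar>))"
    by (cases z rule: int_cases2) simp_all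
  ultimately have "v (of_nat (nat \<bar>z\<bar>)) < 1"
    using val_of_int[of z] by simp
  then have "CHAR('k) dvd nat \<bar>z\<bar>"
    unfolding assms(1) ring_characteristic_residue_field by (intro Gcd_dvd) simp
  then have "of_nat (nat \<bar>z\<bar>) = (0::'k)"
    unfolding of_nat_eq_0_iff_char_dvd .
  then have "v (of_int z) = 0"
    using \<open>v (of_int z) = v (of_nat (nat \<bar>z\<bar>))\<close> by simp
  then show False
    using assms(2) by simp
qed

text \<open>If the field had prime characteristic \<open>p\<close>, Bezout would make every integer
  of valuation below one a multiple of \<open>p\<close>, and the characteristics would agree. In
  characteristic zero they also agree unless some positive integer has valuation below one.\<close>

lemma mixed_characteristic:
  assumes "CHAR('k) \<noteq> ring_characteristic (residue_field v)"
  shows "CHAR('k) = 0" "\<exists>n>0. v (of_nat n) < 1"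
proof -
  let ?I = "{n. v (of_nat n) < 1}"
  show char0: "CHAR('k) = 0"
  proof (rule ccontr)
    assume "CHAR('k) \<noteq> 0"
    then have prime: "prime CHAR('k)"
      using prime_CHAR_semidom[where ?'a = 'k] by simp
    have "CHAR('k) dvd n" if "v (of_nat n) < 1" for n
    proof (rule ccontr)
      assume "\<not> CHAR('k) dvd n"
      then have "coprime (int CHAR('k)) (int n)"
        using prime prime_imp_coprime by simp
      then obtain a b where "a * int CHAR('k) + b * int n = 1"
        by (metis bezout_int coprime_iff_gcd_eq_1)
      then have "of_int (a * int CHAR('k) + b * int n) = (1::'k)"
        by simp
      then have "of_int b * of_nat n = (1::'k)"
        by simp
      then have "v (of_int b) * v (of_nat n) = 1"
        by (metis val_1 val_mult)
      moreover have "v (of_int b) * v (of_nat n) \<le> 1 * v (of_nat n)"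
        by (intro mult_right_mono val_of_int) simp
      ultimately show False
        using that by simp
    qed
    then have "CHAR('k) dvd Gcd ?I"
      by (intro Gcd_greatest) simp
    moreover have "Gcd ?I dvd CHAR('k)"
      by (intro Gcd_dvd) simp
    ultimately show False
      using assms by (simp add: ring_characteristic_residue_field dvd_antisym)
  qed
  show "\<exists>n>0. v (of_nat n) < 1"
  proof (rule ccontr)
    assume "\<nexists>n. n > 0 \<and> v (of_nat n) < 1"
    then have "?I \<subseteq> {0}"
      by auto
    then have "Gcd ?I = 0"
      by simp
    then show False
      using assms char0 by (simp add: ring_characteristic_residue_field)
  qed
qed

text \<open>High powers of an integer \<open>n \<ge> 2\<close> with valuation below one are small
  for the valuation but large in absolute value.\<close>

lemma small_scalar_mixed:
  assumes "CHAR('k) \<noteq> ring_characteristic (residue_field v)" "0 < \<delta>"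
  obtains P N s where "sized_subring P N s" "s \<in> scalar_ring v" "v s < \<delta>"
proof -
  obtain n where n: "0 < n" "v (of_nat n) < 1"
    using mixed_characteristic(2)[OF assms(1)] by blast
  have "n \<noteq> 1"
    using n(2) by auto
  with n(1) have "2 \<le> n"
    by simp
  obtain m where m: "v (of_nat n) ^ m < \<delta>"
    using real_arch_pow_inv[OF assms(2) n(2)] by blast
  \<comment> \<open>The exponent \<open>m\<close> makes the valuation small; the extra 3 guarantees
    \<open>z \<ge> 8\<close>, even if \<open>m = 0\<close>.\<close>
  define z :: int where "z = int n ^ (m + 3)"
  have inj: "of_int a = (of_int b :: 'k) \<longleftrightarrow> a = b" for a b
    using of_int_eq_0_iff_char_dvd[where ?'a = 'k, of "a - b"] mixed_characteristic(1)[OF assms(1)] by simp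
  define N :: "'k \<Rightarrow> real" where "N x = \<bar>of_int (THE a. of_int a = x)\<bar>" for x
  have N: "N (of_int a) = \<bar>of_int a\<bar>" for a
    by (simp add: N_def inj)
  have "(2::int) ^ 3 \<le> 2 ^ (m + 3)"
    by (intro power_increasing) auto
  also have "\<dots> \<le> z"
    unfolding z_def using \<open>2 \<le> n\<close> by (intro power_mono) auto
  finally have "5 \<le> real_of_int z"
    by simp
  then have "sized_subring \<int> N (of_int z)"
  proof unfold_locales
    fix x y :: 'k assume "x \<in> \<int>" "y \<in> \<int>"
    then obtain a b where ab: "x = of_int a" "y = of_int b"
      by (auto elim!: Ints_cases)
    show "N (x * y) = N x * N y"
      using N[of "a * b"] by (simp add: ab N abs_mult)
    show "N (x + y) \<le> N x + N y"
      using N[of "a + b"] by (simp add: ab N)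
  next
    fix x :: 'k assume "x \<in> \<int>"
    then obtain a where a: "x = of_int a"
      by (auto elim!: Ints_cases)
    show "N (- x) = N x"
      using N[of "- a"] by (simp add: a N)
    show "N x = 0 \<longleftrightarrow> x = 0"
      using inj[of a 0] by (simp add: a N)
    show "0 \<le> N x"
      by (simp add: N_def)
  qed (simp_all add: N)
  moreover have "of_int z \<in> scalar_ring v"
    using assms(1) by (simp add: scalar_ring_def)
  moreover have "v (of_int z) < \<delta>"
  proof -
    have "v (of_int z) = v (of_nat n) ^ m * v (of_nat n) ^ 3"
      by (simp add: z_def val_power val_mult power_add)
    also have "\<dots> \<le> v (of_nat n) ^ m * 1"
      by (intro mult_left_mono power_le_one val_of_nat) auto
    finally show ?thesis
      using m by simp
  qed
  ultimately show thesis
    using that by blast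
qed

text \<open>In equal characteristic \<^term>\<open>s\<close> is transcendental over the prime field, since every nonzero
  integer has valuation one. The size is then the exponential of the degree.\<close>

lemma small_scalar_equal:
  assumes "nontrivial_valuation v" "CHAR('k) = ring_characteristic (residue_field v)" "0 < \<delta>"
  obtains P N s where "sized_subring P N s" "s \<in> scalar_ring v" "v s < \<delta>"
proof -
  have "1 \<in> value_group v"
    by (auto simp: value_group_def image_iff intro!: bexI[of _ 1])
  then obtain x where x: "x \<noteq> 0" "v x \<noteq> 1"
    using assms(1) by (auto simp: nontrivial_valuation_def value_group_def)
  define t where "t = (if v x < 1 then x else inverse x)"
  have t: "t \<noteq> 0" "v t < 1"
    using x by (auto simp: t_def val_inverse inverse_less_1_iff)
  \<comment> \<open>The bound 1 excludes \<open>m = 0\<close> and keeps \<open>s\<close> in the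
    maximal ideal, as the transcendence argument requires.\<close>
  obtain m where m: "v t ^ m < min \<delta> 1"
    using real_arch_pow_inv[OF _ t(2), of "min \<delta> 1"] assms(3) by auto
  define s where "s = t ^ m"
  have s: "s \<noteq> 0" "v s < 1" "v s < \<delta>"
    using t m by (auto simp: s_def val_power)
  define I :: "'k poly set" where "I = {p. \<forall>i. coeff p i \<in> \<int>}"
  \<comment> \<open>Horner induction: a nonzero constant term has valuation one and cannot be
    cancelled by a multiple of \<open>s\<close>; if it is zero, the factor \<open>s\<close> is split
    off.\<close>
  have nonzero: "p \<in> I \<Longrightarrow> v (poly p s) \<le> 1 \<and> (p \<noteq> 0 \<longrightarrow> poly p s \<noteq> 0)" for p
  proof (induction p)
    case (pCons c p)
    have "c \<in> \<int>" "p \<in> I"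
      using pCons.prems by (auto simp: I_def coeff_pCons split: nat.splits)
    then have IH: "v (poly p s) \<le> 1" "p \<noteq> 0 \<Longrightarrow> poly p s \<noteq> 0"
      using pCons.IH by auto
    have "v (s * poly p s) \<le> v s * 1"
      unfolding val_mult using IH(1) by (intro mult_left_mono) auto
    then have small: "v (s * poly p s) < 1"
      using s(2) by simp
    show ?case
    proof (cases "c = 0")
      case True
      then show ?thesis
        using small IH(2) s(1) by auto
    next
      case False
      with \<open>c \<in> \<int>\<close> have "v c = 1"
        using val_of_int_equal_characteristic[OF assms(2)] by (auto elim!: Ints_cases)
      then have "v (c + s * poly p s) = 1"
        using val_add_eq[of "s * poly p s" c] small by simp
      then show ?thesis
        by auto
    qed
  qed simp
  have I_0: "0 \<in> I" and I_1: "1 \<in> I" and I_add: "p \<in> I \<Longrightarrow> q \<in> I \<Longrightarrow> p + q \<in> I"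
    and I_uminus: "p \<in> I \<Longrightarrow> - p \<in> I" and I_X: "[:0, 1:] \<in> I" for p q
    by (auto simp: I_def coeff_pCons split: nat.splits)
  have I_mult: "p \<in> I \<Longrightarrow> q \<in> I \<Longrightarrow> p * q \<in> I" for p q
    by (simp add: I_def coeff_mult Ints_sum)
  have inj: "p = q" if "p \<in> I" "q \<in> I" "poly p s = poly q s" for p q
    using nonzero[of "p + - q"] I_add[OF that(1) I_uminus[OF that(2)]] that(3) by auto
  \<comment> \<open>Base 5 gives the polynomial representing \<open>s\<close> exactly the size
    required of it.\<close>
  define size :: "'k poly \<Rightarrow> real" where "size p = (if p = 0 then 0 else 5 ^ degree p)" for p
  define N where "N x = size (THE p. p \<in> I \<and> poly p s = x)" for x
  have N: "N (poly p s) = size p" if "p \<in> I" for p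
  proof -
    have "(THE q. q \<in> I \<and> poly q s = poly p s) = p"
      using that inj by (intro the_equality) auto
    then show ?thesis
      by (simp add: N_def)
  qed
  have size_add: "size (p + q) \<le> size p + size q" for p q
  proof -
    have "(5::real) ^ degree (p + q) \<le> 5 ^ max (degree p) (degree q)"
      by (intro power_increasing degree_add_le_max) simp
    also have "\<dots> \<le> 5 ^ degree p + 5 ^ degree q"
      by (simp add: max_def)
    finally show ?thesis
      by (auto simp: size_def)
  qed
  let ?P = "(\<lambda>p. poly p s) ` I"
  have "sized_subring ?P N s"
  proof unfold_locales
    show "0 \<in> ?P" "1 \<in> ?P" "s \<in> ?P"
      using I_0 I_1 I_X by (force intro: rev_image_eqI)+
    show "5 \<le> N s"
      using N[OF I_X] by (simp add: size_def)
  next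
    fix x y assume "x \<in> ?P" "y \<in> ?P"
    then obtain p q where pq: "p \<in> I" "q \<in> I" "x = poly p s" "y = poly q s"
      by blast
    show "x + y \<in> ?P" "x * y \<in> ?P"
      using I_add I_mult pq by (force intro: rev_image_eqI)+
    show "N (x * y) = N x * N y"
      using N[OF I_mult[OF pq(1,2)]] N[OF pq(1)] N[OF pq(2)] pq(3,4)
      by (auto simp: size_def degree_mult_eq power_add)
    show "N (x + y) \<le> N x + N y"
      using N[OF I_add[OF pq(1,2)]] N[OF pq(1)] N[OF pq(2)] pq(3,4) size_add by simp
  next
    fix x assume "x \<in> ?P"
    then obtain p where p: "p \<in> I" "x = poly p s"
      by blast
    show "- x \<in> ?P"
      using I_uminus p by (force intro: rev_image_eqI)
    show "N (- x) = N x"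
      using N[OF I_uminus[OF p(1)]] N[OF p(1)] p(2) by (simp add: size_def)
    show "0 \<le> N x"
      using N[OF p(1)] p(2) by (simp add: size_def)
    show "N x = 0 \<longleftrightarrow> x = 0"
      using N[OF p(1)] p nonzero[OF p(1)] by (auto simp: size_def)
  qed
  moreover have "s \<in> scalar_ring v"
    using assms(2) s(2) by (simp add: scalar_ring_def valuation_ring_def)
  ultimately show thesis
    using that s(3) by blast
qed

lemma small_scalar:
  assumes "nontrivial_valuation v" "0 < \<delta>"
  obtains P N s where "sized_subring P N s" "s \<in> scalar_ring v" "v s < \<delta>"
  using small_scalar_mixed[OF _ assms(2)] small_scalar_equal[OF assms(1) _ assms(2)] by blast

end

subsection \<open>Calculus of equidecomposability\<close>

lemma equidecomposable_image:
  assumes "g \<in> carrier G" "\<phi> g ` A = B"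
  shows "equidecomposable G \<phi> 1 A B"
  unfolding equidecomposable_def
  by (rule exI[of _ "\<lambda>_. A"], rule exI[of _ "\<lambda>_. B"], rule exI[of _ "\<lambda>_. g"])
     (use assms in \<open>auto simp: disjoint_family_on_def lessThan_Suc\<close>)

lemma equidecomposable_Un:
  fixes A B A' B' :: "'x set"
  assumes "equidecomposable G \<phi> m A B" "equidecomposable G \<phi> l A' B'"
    and "A \<inter> A' = {}" "B \<inter> B' = {}"
  shows "equidecomposable G \<phi> (m + l) (A \<union> A') (B \<union> B')"
proof -
  obtain P Q g where 1: "disjoint_family_on P {..<m}" "(\<Union>i<m. P i) = A"
      "disjoint_family_on Q {..<m}" "(\<Union>i<m. Q i) = B"
      "\<And>i. i < m \<Longrightarrow> g i \<in> carrier G \<and> \<phi> (g i) ` P i = Q i"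
    using assms(1) unfolding equidecomposable_def by blast
  obtain P' Q' g' where 2: "disjoint_family_on P' {..<l}" "(\<Union>i<l. P' i) = A'"
      "disjoint_family_on Q' {..<l}" "(\<Union>i<l. Q' i) = B'"
      "\<And>i. i < l \<Longrightarrow> g' i \<in> carrier G \<and> \<phi> (g' i) ` P' i = Q' i"
    using assms(2) unfolding equidecomposable_def by blast
  have disj: "disjoint_family_on (\<lambda>i. if i < m then R i else R' (i - m)) {..<m + l}"
    if R: "disjoint_family_on R {..<m}" "disjoint_family_on R' {..<l}"
      "(\<Union>i<m. R i) \<inter> (\<Union>i<l. R' i) = {}" for R R' :: "nat \<Rightarrow> 'x set"
    unfolding disjoint_family_on_def
  proof (intro ballI impI)
    fix i j assume ij: "i \<in> {..<m + l}" "j \<in> {..<m + l}" "i \<noteq> j"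
    have mixed: "R a \<inter> R' b = {}" if "a < m" "b < l" for a b
      using R(3) that by blast
    consider "i < m" "j < m" | "i < m" "m \<le> j" | "m \<le> i" "j < m" | "m \<le> i" "m \<le> j"
      by linarith
    then show "(if i < m then R i else R' (i - m)) \<inter> (if j < m then R j else R' (j - m)) = {}"
    proof cases
      case 1
      then show ?thesis
        using disjoint_family_onD[OF R(1), of i j] ij by simp
    next
      case 2
      then show ?thesis
        using mixed[of i "j - m"] ij by simp
    next
      case 3
      then show ?thesis
        using mixed[of j "i - m"] ij by (simp add: Int_commute)
    next
      case 4
      then show ?thesis
        using disjoint_family_onD[OF R(2), of "i - m" "j - m"] ij by simp
    qed
  qed
  have union: "(\<Union>i<m + l. if i < m then R i else R' (i - m)) = (\<Union>i<m. R i) \<union> (\<Union>i<l. R' i)"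
    for R R' :: "nat \<Rightarrow> 'x set"
  proof (intro equalityI subsetI)
    fix x assume "x \<in> (\<Union>i<m + l. if i < m then R i else R' (i - m))"
    then obtain i where "i < m + l" "x \<in> (if i < m then R i else R' (i - m))"
      by blast
    then have "(i < m \<and> x \<in> R i) \<or> (i - m < l \<and> x \<in> R' (i - m))"
      by (cases "i < m") simp_all
    then show "x \<in> (\<Union>i<m. R i) \<union> (\<Union>i<l. R' i)"
      by blast
  next
    fix x assume "x \<in> (\<Union>i<m. R i) \<union> (\<Union>i<l. R' i)"
    then consider i where "i < m" "x \<in> R i" | i where "i < l" "x \<in> R' i"
      by blast
    then show "x \<in> (\<Union>i<m + l. if i < m then R i else R' (i - m))"
    proof cases
      case (1 i)
      then show ?thesis
        by (intro UN_I[of i]) simp_all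
    next
      case (2 i)
      then show ?thesis
        by (intro UN_I[of "i + m"]) simp_all
    qed
  qed
  let ?join = "\<lambda>R R' i. if i < m then R i else R' (i - m)"
  have "disjoint_family_on (?join P P') {..<m + l}" "disjoint_family_on (?join Q Q') {..<m + l}"
    using disj 1 2 assms(3,4) by simp_all
  moreover have "(\<Union>i<m + l. ?join P P' i) = A \<union> A'" "(\<Union>i<m + l. ?join Q Q' i) = B \<union> B'"
    unfolding union using 1 2 by simp_all
  moreover have "\<forall>i<m + l. ?join g g' i \<in> carrier G \<and> \<phi> (?join g g' i) ` ?join P P' i = ?join Q Q' i"
    using 1(5) 2(5) by simp
  ultimately show ?thesis
    unfolding equidecomposable_def
    by (intro exI[of _ "?join P P'"] exI[of _ "?join Q Q'"] exI[of _ "?join g g'"] conjI)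
qed

text \<open>Common refinement: the index \<open>k < m * l\<close> encodes the pair
  \<open>(k div l, k mod l)\<close>, and \<open>R k\<close> collects the points of the first piece
  that are sent into the second. Injectivity keeps the images of disjoint refinements
  disjoint.\<close>

lemma equidecomposable_trans:
  assumes "equidecomposable G \<phi> m A B" "equidecomposable G \<phi> l B C"
    and comp: "\<And>g h. g \<in> carrier G \<Longrightarrow> h \<in> carrier G \<Longrightarrow> g \<otimes>\<^bsub>G\<^esub> h \<in> carrier G \<and> \<phi> (g \<otimes>\<^bsub>G\<^esub> h) = \<phi> g \<circ> \<phi> h"
    and inj: "\<And>g. g \<in> carrier G \<Longrightarrow> inj (\<phi> g)"
  shows "equidecomposable G \<phi> (m * l) A C"
proof -
  obtain P Q g where 1: "disjoint_family_on P {..<m}" "(\<Union>i<m. P i) = A"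
      "disjoint_family_on Q {..<m}" "(\<Union>i<m. Q i) = B"
      "\<And>i. i < m \<Longrightarrow> g i \<in> carrier G \<and> \<phi> (g i) ` P i = Q i"
    using assms(1) unfolding equidecomposable_def by blast
  obtain P' Q' g' where 2: "disjoint_family_on P' {..<l}" "(\<Union>i<l. P' i) = B"
      "disjoint_family_on Q' {..<l}" "(\<Union>i<l. Q' i) = C"
      "\<And>i. i < l \<Longrightarrow> g' i \<in> carrier G \<and> \<phi> (g' i) ` P' i = Q' i"
    using assms(2) unfolding equidecomposable_def by blast
  have idx: "k div l < m" "k mod l < l" if "k < m * l" for k
    using that by (auto simp: less_mult_imp_div_less) (metis mod_less_divisor mult_0_right not_gr_zero not_less_zero)
  have idx_inv: "\<exists>k<m * l. k div l = i \<and> k mod l = j" if "i < m" "j < l" for i j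
  proof (intro exI conjI)
    have "i * l + j < Suc i * l"
      using that by simp
    also have "\<dots> \<le> m * l"
      using that by (intro mult_le_mono1) simp
    finally show "i * l + j < m * l" .
  qed (use that in simp_all)
  have idx_neq: "k div l \<noteq> k' div l \<or> k mod l \<noteq> k' mod l" if "k \<noteq> k'" for k k'
    using that by (metis div_mult_mod_eq)
  define R where "R k = {x \<in> P (k div l). \<phi> (g (k div l)) x \<in> P' (k mod l)}" for k
  define T where "T k = \<phi> (g' (k mod l)) ` (Q (k div l) \<inter> P' (k mod l))" for k
  define f where "f k = g' (k mod l) \<otimes>\<^bsub>G\<^esub> g (k div l)" for k
  have disjR: "disjoint_family_on R {..<m * l}"
    unfolding disjoint_family_on_def
  proof (intro ballI impI)
    fix k k' assume k: "k \<in> {..<m * l}" "k' \<in> {..<m * l}" "k \<noteq> k'"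
    show "R k \<inter> R k' = {}"
    proof (cases "k div l = k' div l")
      case True
      then have "P' (k mod l) \<inter> P' (k' mod l) = {}"
        using idx_neq[OF k(3)] idx[of k] idx[of k'] k by (intro disjoint_family_onD[OF 2(1)]) auto
      then show ?thesis
        using True by (auto simp: R_def)
    next
      case False
      then have "P (k div l) \<inter> P (k' div l) = {}"
        using idx[of k] idx[of k'] k by (intro disjoint_family_onD[OF 1(1)]) auto
      then show ?thesis
        by (auto simp: R_def)
    qed
  qed
  have disjT: "disjoint_family_on T {..<m * l}"
    unfolding disjoint_family_on_def
  proof (intro ballI impI)
    fix k k' assume k: "k \<in> {..<m * l}" "k' \<in> {..<m * l}" "k \<noteq> k'"
    have sub: "T k \<subseteq> Q' (k mod l)" if "k < m * l" for k
      using 2(5)[OF idx(2)[OF that]] by (auto simp: T_def)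
    show "T k \<inter> T k' = {}"
    proof (cases "k mod l = k' mod l")
      case True
      then have "Q (k div l) \<inter> Q (k' div l) = {}"
        using idx_neq[OF k(3)] idx[of k] idx[of k'] k by (intro disjoint_family_onD[OF 1(3)]) auto
      moreover have "inj (\<phi> (g' (k mod l)))"
        using 2(5) idx[of k] k by (intro inj) auto
      ultimately show ?thesis
        unfolding T_def True[symmetric] by (subst image_Int[symmetric]) auto
    next
      case False
      then have "Q' (k mod l) \<inter> Q' (k' mod l) = {}"
        using idx[of k] idx[of k'] k by (intro disjoint_family_onD[OF 2(3)]) auto
      then show ?thesis
        using sub[of k] sub[of k'] k by blast
    qed
  qed
  have "(\<Union>k<m * l. R k) = A"
  proof (intro equalityI subsetI)
    fix x assume "x \<in> A"
    then obtain i where i: "i < m" "x \<in> P i"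
      using 1(2) by blast
    then have "\<phi> (g i) x \<in> B"
      using 1(4,5) by blast
    then obtain j where j: "j < l" "\<phi> (g i) x \<in> P' j"
      using 2(2) by blast
    obtain k where "k < m * l" "k div l = i" "k mod l = j"
      using idx_inv[OF i(1) j(1)] by blast
    then show "x \<in> (\<Union>k<m * l. R k)"
      using i j by (auto simp: R_def)
  next
    fix x assume "x \<in> (\<Union>k<m * l. R k)"
    then obtain k where "k < m * l" "x \<in> P (k div l)"
      by (auto simp: R_def)
    then show "x \<in> A"
      using idx[of k] 1(2) by blast
  qed
  moreover have "(\<Union>k<m * l. T k) = C"
  proof (intro equalityI subsetI)
    fix z assume "z \<in> C"
    then obtain j where j: "j < l" "z \<in> Q' j"
      using 2(4) by blast
    then obtain y where y: "y \<in> P' j" "z = \<phi> (g' j) y"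
      using 2(5) by blast
    then have "y \<in> B"
      using j 2(2) by blast
    then obtain i where i: "i < m" "y \<in> Q i"
      using 1(4) by blast
    obtain k where "k < m * l" "k div l = i" "k mod l = j"
      using idx_inv[OF i(1) j(1)] by blast
    then show "z \<in> (\<Union>k<m * l. T k)"
      using i y by (auto simp: T_def)
  next
    fix z assume "z \<in> (\<Union>k<m * l. T k)"
    then obtain k y where k: "k < m * l" "y \<in> P' (k mod l)" "z = \<phi> (g' (k mod l)) y"
      by (auto simp: T_def)
    then show "z \<in> C"
      using idx[of k] 2(4,5) by blast
  qed
  moreover have "f k \<in> carrier G \<and> \<phi> (f k) ` R k = T k" if "k < m * l" for k
  proof -
    have "\<phi> (g (k div l)) ` R k = Q (k div l) \<inter> P' (k mod l)"
      using 1(5)[OF idx(1)[OF that]] by (auto simp: R_def)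
    then have "(\<phi> (g' (k mod l)) \<circ> \<phi> (g (k div l))) ` R k = T k"
      unfolding image_comp[symmetric] T_def by simp
    then show ?thesis
      using comp[of "g' (k mod l)" "g (k div l)"] 1(5) 2(5) idx[OF that] by (simp add: f_def)
  qed
  ultimately show ?thesis
    unfolding equidecomposable_def using disjR disjT
    by (intro exI[of _ R] exI[of _ T] exI[of _ f] conjI allI impI) simp_all
qed

text \<open>Hilbert's hotel: \<^term>\<open>\<phi> g\<close> pulls the union of the \<open>f\<^sup>k B\<close>, \<open>k \<ge> 1\<close>, back by one step.\<close>

lemma equidecomposable_absorb:
  assumes "e \<in> carrier G" "\<phi> e = id" "g \<in> carrier G"
    and disj: "X \<inter> B = {}"
    and f_closed: "\<And>x. x \<in> X \<union> B \<Longrightarrow> f x \<in> X \<union> B"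
    and g_f: "\<And>x. x \<in> X \<union> B \<Longrightarrow> \<phi> g (f x) = x"
    and leaves: "\<And>x k. x \<in> B \<Longrightarrow> (f ^^ Suc k) x \<notin> B"
  shows "equidecomposable G \<phi> 2 X (X \<union> B)"
proof -
  \<comment> \<open>The union starts at the first iterate: \<open>leaves\<close> then puts
    \<open>C\<close> inside \<open>X\<close>, and pulling back by one step adds exactly
    \<open>B\<close>.\<close>
  define C where "C = (\<Union>k. (f ^^ Suc k) ` B)"
  have iter: "(f ^^ k) x \<in> X \<union> B" if "x \<in> B" for x k
    using that f_closed by (induction k) auto
  have "C \<subseteq> X"
  proof
    fix y assume "y \<in> C"
    then obtain k x where "x \<in> B" "y = (f ^^ Suc k) x"
      unfolding C_def by blast
    then show "y \<in> X"
      using iter[of x "Suc k"] leaves[of x k] by blast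
  qed
  have "\<phi> g ` C = B \<union> C"
  proof -
    have "\<phi> g ` C = (\<Union>k. (f ^^ k) ` B)"
    proof -
      have "\<phi> g ((f ^^ Suc k) x) = (f ^^ k) x" if "x \<in> B" for x k
        using g_f[OF iter[OF that, of k]] by simp
      then have "\<phi> g ` (f ^^ Suc k) ` B = (f ^^ k) ` B" for k
        unfolding image_image by (intro image_cong) auto
      then show ?thesis
        unfolding C_def image_UN by simp
    qed
    also have "\<dots> = (f ^^ 0) ` B \<union> C"
      unfolding C_def by (subst UNIV_nat_eq) (simp only: UN_insert image_image)
    finally show ?thesis
      by simp
  qed
  then have "equidecomposable G \<phi> 1 C (B \<union> C)"
    using assms(3) by (intro equidecomposable_image)
  moreover have "equidecomposable G \<phi> 1 (X - C) (X - C)"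
    using assms(1,2) by (intro equidecomposable_image[of e]) simp_all
  ultimately have "equidecomposable G \<phi> (1 + 1) (C \<union> (X - C)) ((B \<union> C) \<union> (X - C))"
    by (rule equidecomposable_Un) (use disj in auto)
  moreover have "C \<union> (X - C) = X" "(B \<union> C) \<union> (X - C) = X \<union> B"
    using \<open>C \<subseteq> X\<close> by auto
  ultimately show ?thesis
    by (simp add: numeral_2_eq_2)
qed

subsection \<open>Block matrices\<close>

text \<open>\<open>F\<close> contains one index from each coordinate plane and \<open>\<tau>\<close>
  gives its partner; the planes need not exhaust all coordinates.\<close>

definition pairing :: "'n set \<Rightarrow> ('n \<Rightarrow> 'n) \<Rightarrow> bool" where
  "pairing F \<tau> \<longleftrightarrow> (\<forall>i\<in>F. \<tau> i \<notin> F \<and> \<tau> (\<tau> i) = i)"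

definition shear_matrix :: "'n set \<Rightarrow> ('n \<Rightarrow> 'n) \<Rightarrow> 'k::field \<Rightarrow> 'k ^ 'n ^ 'n" where
  "shear_matrix F \<tau> c = (\<chi> i j. if i = j then 1 else if i \<in> F \<and> j = \<tau> i then c else 0)"

text \<open>The generators of the free group acting on each of the coordinate planes spanned by
  \<open>i\<close> and \<open>\<tau> i\<close> for \<open>i \<in> F\<close>.\<close>

definition letter_matrix :: "'n set \<Rightarrow> ('n \<Rightarrow> 'n) \<Rightarrow> 'k::field \<Rightarrow> bool \<times> bool \<Rightarrow> 'k ^ 'n ^ 'n" where
  "letter_matrix F \<tau> s c =
     (if snd c
      then shear_matrix F \<tau> (letter_param s c) ** shear_matrix (\<tau> ` F) \<tau> (letter_param s c)
      else shear_matrix (\<tau> ` F) \<tau> (- letter_param s c) ** shear_matrix F \<tau> (- letter_param s c))"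

lemma pairing_image: "pairing F \<tau> \<Longrightarrow> pairing (\<tau> ` F) \<tau>"
  by (auto simp: pairing_def)

lemma even_set_pairing:
  assumes "finite U" "even (card U)"
  obtains F \<tau> where "pairing F \<tau>" "F \<union> \<tau> ` F = U"
proof -
  obtain F where F: "F \<subseteq> U" "card F = card U div 2" "finite F"
    using obtain_subset_with_card_n[of "card U div 2" U] by auto
  then have "card (U - F) = card F"
    using assms by (auto simp: card_Diff_subset)
  then obtain f where f: "bij_betw f F (U - F)"
    using finite_same_card_bij[of F "U - F"] F assms(1) by auto
  define \<tau> where "\<tau> i = (if i \<in> F then f i else inv_into F f i)" for i
  have "f i \<in> U - F" "inv_into F f (f i) = i" if "i \<in> F" for i
    using f that by (auto simp: bij_betw_def)
  then have "pairing F \<tau>"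
    by (auto simp: pairing_def \<tau>_def)
  moreover have "\<tau> ` F = U - F"
    using f by (simp add: \<tau>_def bij_betw_def)
  ultimately show thesis
    using that F(1) by blast
qed

lemma shear_matrix_apply:
  fixes y :: "'k::field ^ 'n"
  assumes "pairing F \<tau>"
  shows "(shear_matrix F \<tau> c *v y) $ i = y $ i + (if i \<in> F then c * y $ \<tau> i else 0)"
proof -
  have "(shear_matrix F \<tau> c *v y) $ i =
      (\<Sum>j\<in>UNIV. (if j = i then y $ j else 0) + (if j = \<tau> i then if i \<in> F then c * y $ j else 0 else 0))"
    unfolding matrix_vector_mult_def shear_matrix_def vec_lambda_beta
    using assms by (intro sum.cong) (auto simp: pairing_def)
  also have "\<dots> = y $ i + (if i \<in> F then c * y $ \<tau> i else 0)"
    by (simp add: sum.distrib)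
  finally show ?thesis .
qed

text \<open>Enlarging \<open>F\<close> by \<open>i\<close> is a row operation: row
  \<open>\<tau> i\<close> is still a unit vector, and \<open>c\<close> times it is added to row
  \<open>i\<close>.\<close>

lemma det_shear_matrix:
  assumes "pairing F \<tau>"
  shows "det (shear_matrix F \<tau> c :: 'k::field ^ 'n ^ 'n) = 1"
proof -
  have "finite F"
    by simp
  then show ?thesis
    using assms
  proof (induction F rule: finite_induct)
    case empty
    have "shear_matrix {} \<tau> c = (mat 1 :: 'k ^ 'n ^ 'n)"
      by (simp add: vec_eq_iff shear_matrix_def mat_def)
    then show ?case
      by simp
  next
    case (insert i F)
    then have \<tau>: "\<tau> i \<noteq> i" "\<tau> i \<notin> F" and "pairing F \<tau>"
      by (auto simp: pairing_def)
    let ?A = "shear_matrix F \<tau> c :: 'k ^ 'n ^ 'n"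
    have "shear_matrix (insert i F) \<tau> c =
        (\<chi> k. if k = i then row i ?A + c *s row (\<tau> i) ?A else row k ?A)"
      using \<tau> insert.hyps(2) by (auto simp: vec_eq_iff shear_matrix_def row_def)
    then show ?case
      using det_row_operation[of i "\<tau> i" ?A c] insert.IH[OF \<open>pairing F \<tau>\<close>] \<tau>(1) by simp
  qed
qed

lemma letter_matrix_apply:
  fixes y :: "'k::field ^ 'n"
  assumes "pairing F \<tau>"
  shows "i \<in> F \<Longrightarrow> ((letter_matrix F \<tau> s c *v y) $ i, (letter_matrix F \<tau> s c *v y) $ \<tau> i) =
      pair_act s c (y $ i, y $ \<tau> i)"
    and "i \<notin> F \<union> \<tau> ` F \<Longrightarrow> (letter_matrix F \<tau> s c *v y) $ i = y $ i"
  using assms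
  by (auto simp: letter_matrix_def matrix_vector_mul_assoc[symmetric] shear_matrix_apply[OF assms]
      shear_matrix_apply[OF pairing_image[OF assms]] pair_act_def shears_def inv_shears_def Let_def pairing_def)

lemma letter_matrix_inv_letter:
  fixes y :: "'k::field ^ 'n"
  assumes "pairing F \<tau>"
  shows "letter_matrix F \<tau> s (inv_letter c) *v (letter_matrix F \<tau> s c *v y) = y"
proof -
  let ?z = "letter_matrix F \<tau> s (inv_letter c) *v (letter_matrix F \<tau> s c *v y)"
  have pair: "(?z $ i, ?z $ \<tau> i) = (y $ i, y $ \<tau> i)" if "i \<in> F" for i
    by (simp only: letter_matrix_apply(1)[OF assms that] pair_act_inv_letter)
  have "?z $ i = y $ i" for i
  proof (cases "i \<in> F \<union> \<tau> ` F")
    case True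
    then consider "i \<in> F" | j where "j \<in> F" "i = \<tau> j"
      by blast
    then show ?thesis
      using pair by cases (simp_all only: prod.inject)
  next
    case False
    then show ?thesis
      by (simp only: letter_matrix_apply(2)[OF assms False])
  qed
  then show ?thesis
    by (simp add: vec_eq_iff)
qed

text \<open>A word fixing \<open>y\<close> fixes its component in every paired plane. One of these
  components is nonzero, which \<open>reduced_word_fixes_only_zero\<close> excludes.\<close>

lemma (in sized_subring) free_action_letter_matrix:
  fixes S :: "('k ^ 'n) set"
  assumes "pairing F \<tau>" and closed: "\<And>c y. y \<in> S \<Longrightarrow> letter_matrix F \<tau> s c *v y \<in> S"
  shows "free_action {y \<in> S. \<exists>i\<in>F \<union> \<tau> ` F. y $ i \<noteq> 0} (\<lambda>c y. letter_matrix F \<tau> s c *v y)"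
proof
  let ?X = "{y \<in> S. \<exists>i\<in>F \<union> \<tau> ` F. y $ i \<noteq> 0}"
  have X_iff: "y \<in> ?X \<longleftrightarrow> y \<in> S \<and> (\<exists>i\<in>F. (y $ i, y $ \<tau> i) \<noteq> (0, 0))" for y
    by auto
  show inv: "letter_matrix F \<tau> s (inv_letter c) *v (letter_matrix F \<tau> s c *v y) = y" for c y
    using assms(1) by (rule letter_matrix_inv_letter)
  show "letter_matrix F \<tau> s c *v y \<in> ?X" if "y \<in> ?X" for c y
  proof -
    let ?z = "letter_matrix F \<tau> s c *v y"
    obtain i where i: "y \<in> S" "i \<in> F" "(y $ i, y $ \<tau> i) \<noteq> (0, 0)"
      using \<open>y \<in> ?X\<close> unfolding X_iff by blast
    have "(?z $ i, ?z $ \<tau> i) \<noteq> (0, 0)"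
    proof
      assume "(?z $ i, ?z $ \<tau> i) = (0, 0)"
      then have "pair_act s (inv_letter c) (0, 0) = (y $ i, y $ \<tau> i)"
        using letter_matrix_apply(1)[OF assms(1) i(2), of s c y] pair_act_inv_letter[of s c "(y $ i, y $ \<tau> i)"]
        by simp
      then show False
        using i(3) by (simp add: pair_act_def shears_def inv_shears_def Let_def split: if_splits)
    qed
    then show ?thesis
      unfolding X_iff using i closed by blast
  qed
  show "foldr (\<lambda>c y. letter_matrix F \<tau> s c *v y) w y \<noteq> y"
    if w: "reduced w" "w \<noteq> []" and y: "y \<in> ?X" for w y
  proof
    assume fixed: "foldr (\<lambda>c y. letter_matrix F \<tau> s c *v y) w y = y"
    obtain i where i: "i \<in> F" "(y $ i, y $ \<tau> i) \<noteq> (0, 0)"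
      using y unfolding X_iff by blast
    have "(foldr (\<lambda>c y. letter_matrix F \<tau> s c *v y) u y $ i,
           foldr (\<lambda>c y. letter_matrix F \<tau> s c *v y) u y $ \<tau> i) =
        foldr (pair_act s) u (y $ i, y $ \<tau> i)" for u
      by (induction u) (simp_all add: letter_matrix_apply(1)[OF assms(1) i(1)])
    then show False
      using reduced_word_fixes_only_zero[OF w] i(2) fixed by metis
  qed
qed

subsection \<open>The congruence group and the spheres\<close>

context nonarch_field
begin

lemma scalar_ring_closed:
  shows "0 \<in> scalar_ring v" "1 \<in> scalar_ring v"
    and "x \<in> scalar_ring v \<Longrightarrow> y \<in> scalar_ring v \<Longrightarrow> x + y \<in> scalar_ring v"
    and "x \<in> scalar_ring v \<Longrightarrow> y \<in> scalar_ring v \<Longrightarrow> x * y \<in> scalar_ring v"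
    and "x \<in> scalar_ring v \<Longrightarrow> - x \<in> scalar_ring v"
proof -
  have "v (x * y) \<le> 1" if "v x \<le> 1" "v y \<le> 1"
    using that by (simp add: val_mult mult_le_one)
  moreover have "v (x + y) \<le> 1" if "v x \<le> 1" "v y \<le> 1"
    using that val_add[of x y] by simp
  ultimately show "0 \<in> scalar_ring v" "1 \<in> scalar_ring v"
    and "x \<in> scalar_ring v \<Longrightarrow> y \<in> scalar_ring v \<Longrightarrow> x + y \<in> scalar_ring v"
    and "x \<in> scalar_ring v \<Longrightarrow> y \<in> scalar_ring v \<Longrightarrow> x * y \<in> scalar_ring v"
    and "x \<in> scalar_ring v \<Longrightarrow> - x \<in> scalar_ring v"
    by (auto simp: scalar_ring_def valuation_ring_def simp flip: Ints_def split: if_splits)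
qed

lemma SL_eps_iff:
  "A \<in> carrier (SL_eps v R \<epsilon>) \<longleftrightarrow>
     (\<forall>i j. A $ i $ j \<in> R) \<and> det A = 1 \<and> (\<forall>i j. v ((A - mat 1) $ i $ j) < \<epsilon>)"
  by (auto simp: SL_eps_def mat_def)

text \<open>Writing \<open>I\<close> for the identity, \<open>A B - I = A (B - I) + (A - I)\<close>,
  and the entries of \<open>A\<close> have valuation at most one because
  \<open>\<epsilon> \<le> 1\<close>.\<close>

lemma SL_eps_mult:
  assumes "\<epsilon> \<le> 1" "0 < \<epsilon>"
    and A: "A \<in> carrier (SL_eps v (scalar_ring v) \<epsilon>)" and B: "B \<in> carrier (SL_eps v (scalar_ring v) \<epsilon>)"
  shows "A ** B \<in> carrier (SL_eps v (scalar_ring v) \<epsilon>)"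
  unfolding SL_eps_iff
proof (intro conjI allI)
  have sum: "sum f I \<in> scalar_ring v" if "finite I" "\<And>i. i \<in> I \<Longrightarrow> f i \<in> scalar_ring v" for f and I :: "'n set"
    using that by (induction I rule: finite_induct) (auto intro: scalar_ring_closed)
  have entries: "A $ i $ j \<in> scalar_ring v" "B $ i $ j \<in> scalar_ring v" for i j
    using A B unfolding SL_eps_iff by blast+
  show "(A ** B) $ i $ j \<in> scalar_ring v" for i j
    unfolding matrix_matrix_mult_def vec_lambda_beta
    by (intro sum scalar_ring_closed(4) entries finite)
  show "det (A ** B) = 1"
    using A B by (simp add: SL_eps_iff det_mul)
  show "v ((A ** B - mat 1) $ i $ j) < \<epsilon>" for i j
  proof -
    have A_le: "v (A $ i $ k) \<le> 1" for k
    proof -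
      have "v ((A - mat 1) $ i $ k + mat 1 $ i $ k) \<le> max (v ((A - mat 1) $ i $ k)) (v (mat 1 $ i $ k))"
        by (rule val_add)
      also have "v ((A - mat 1) $ i $ k) < \<epsilon>"
        using A unfolding SL_eps_iff by blast
      then have "v ((A - mat 1) $ i $ k) \<le> 1"
        using assms(1) by linarith
      then have "max (v ((A - mat 1) $ i $ k)) (v (mat 1 $ i $ k)) \<le> 1"
        by (simp add: mat_def)
      finally show ?thesis
        by simp
    qed
    have "v (A $ i $ k * (B - mat 1) $ k $ j) < \<epsilon>" for k
    proof -
      have "v (A $ i $ k) * v ((B - mat 1) $ k $ j) \<le> 1 * v ((B - mat 1) $ k $ j)"
        by (intro mult_right_mono A_le) simp
      also have "\<dots> < \<epsilon>"
        using B unfolding SL_eps_iff by simp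
      finally show ?thesis
        by (simp add: val_mult)
    qed
    then have "v ((A ** (B - mat 1)) $ i $ j) < \<epsilon>"
      unfolding matrix_matrix_mult_def by (simp add: val_sum_less assms(2))
    moreover have "(A ** B - mat 1) $ i $ j = (A ** (B - mat 1)) $ i $ j + (A - mat 1) $ i $ j"
      using matrix_add_ldistrib[of A "B - mat 1" "mat 1"] by simp
    moreover have "v ((A - mat 1) $ i $ j) < \<epsilon>"
      using A unfolding SL_eps_iff by blast
    ultimately show ?thesis
      by (simp only: val_add_less)
  qed
qed

lemma letter_matrix_in_SL_eps:
  assumes "pairing F \<tau>" "\<epsilon> \<le> 1" "0 < \<epsilon>" "s \<in> scalar_ring v" "v s < \<epsilon>"
  shows "letter_matrix F \<tau> s c \<in> carrier (SL_eps v (scalar_ring v) \<epsilon>)"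
proof -
  have "v s * v s \<le> v s * 1"
    using assms by (intro mult_left_mono) auto
  then have t: "letter_param s c \<in> scalar_ring v" "v (letter_param s c) < \<epsilon>"
    using assms scalar_ring_closed by (auto simp: letter_param_def val_mult)
  have "shear_matrix F' \<tau> t \<in> carrier (SL_eps v (scalar_ring v) \<epsilon>)"
    if "pairing F' \<tau>" "t \<in> scalar_ring v" "v t < \<epsilon>" for F' t
    using that assms(3) scalar_ring_closed
    by (auto simp: SL_eps_iff det_shear_matrix) (auto simp: shear_matrix_def mat_def)
  then show ?thesis
    using assms t pairing_image[OF assms(1)] scalar_ring_closed
    by (simp add: letter_matrix_def SL_eps_mult)
qed

lemma mat_1_in_SL_eps: "0 < \<epsilon> \<Longrightarrow> mat 1 \<in> carrier (SL_eps v (scalar_ring v) \<epsilon>)"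
  using scalar_ring_closed by (auto simp: SL_eps_iff) (auto simp: mat_def)

lemma SL_eps_mono: "\<delta> \<le> \<epsilon> \<Longrightarrow> carrier (SL_eps v R \<delta>) \<subseteq> carrier (SL_eps v R \<epsilon>)"
  by (auto simp: SL_eps_iff) (meson less_le_trans)

section \<open>The maximum norm and invariance of spheres\<close>

lemma val_le_max_norm: "v (x $ i) \<le> max_norm v x"
  by (simp add: max_norm_def)

lemma max_norm_attained: "\<exists>i. v (x $ i) = max_norm v x"
proof -
  have "Max (range (\<lambda>i. v (x $ i))) \<in> range (\<lambda>i. v (x $ i))"
    by (rule Max_in) auto
  then obtain i where "Max (range (\<lambda>i. v (x $ i))) = v (x $ i)"
    by blast
  then show ?thesis
    by (intro exI[of _ i]) (simp add: max_norm_def)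
qed

lemma vsphere_iff: "y \<in> vsphere v x r \<longleftrightarrow> (\<forall>i. v (y $ i - x $ i) \<le> r) \<and> (\<exists>i. v (y $ i - x $ i) = r)"
proof -
  have "Max (range (\<lambda>i. v ((y - x) $ i))) = r \<longleftrightarrow>
      r \<in> range (\<lambda>i. v ((y - x) $ i)) \<and> (\<forall>a\<in>range (\<lambda>i. v ((y - x) $ i)). a \<le> r)"
    by (rule Max_eq_iff) auto
  then show ?thesis
    by (auto simp: vsphere_def max_norm_def)
qed

text \<open>Points of the sphere have norm at most \<open>max r (max_norm v x)\<close>, so
  \<open>A\<close> moves each coordinate by less than \<open>r\<close>. By the ultrametric
  inequality such a displacement keeps the distance to \<open>x\<close> equal to
  \<open>r\<close>.\<close>

lemma SL_eps_preserves_vsphere: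
  assumes A: "A \<in> carrier (SL_eps v R \<delta>)" and "0 < r" "\<delta> * max r (max_norm v x) \<le> r"
    and y: "y \<in> vsphere v x r"
  shows "A *v y \<in> vsphere v x r"
proof -
  let ?\<rho> = "max r (max_norm v x)"
  have "v ((A *v y - y) $ i) < r" for i
  proof -
    have "v ((A - mat 1) $ i $ j * y $ j) < r" for j
    proof -
      have "v (y $ j) \<le> max (v (y $ j - x $ j)) (v (x $ j))"
        using val_add[of "y $ j - x $ j" "x $ j"] by simp
      also have "\<dots> \<le> ?\<rho>"
        using y val_le_max_norm by (intro max.mono) (simp_all add: vsphere_iff)
      finally have "v ((A - mat 1) $ i $ j) * v (y $ j) \<le> v ((A - mat 1) $ i $ j) * ?\<rho>"
        by (intro mult_left_mono) auto
      also have "\<dots> < \<delta> * ?\<rho>"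
        using A assms(2) unfolding SL_eps_iff by (intro mult_strict_right_mono) (auto simp: less_max_iff_disj)
      finally show ?thesis
        using assms(3) by (simp add: val_mult)
    qed
    then have "v (((A - mat 1) *v y) $ i) < r"
      unfolding matrix_vector_mult_def by (simp add: val_sum_less assms(2))
    then show ?thesis
      by (simp add: matrix_vector_mult_diff_rdistrib)
  qed
  then have close: "v ((A *v y) $ i - y $ i) < r" for i
    by simp
  have "v ((A *v y) $ i - x $ i) \<le> r" for i
  proof -
    have "v ((A *v y) $ i - x $ i) \<le> max (v ((A *v y) $ i - y $ i)) (v (y $ i - x $ i))"
      using val_add[of "(A *v y) $ i - y $ i" "y $ i - x $ i"] by simp
    also have "\<dots> \<le> r"
      using close[of i] y by (simp add: vsphere_iff)
    finally show ?thesis .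
  qed
  moreover obtain i where i: "v (y $ i - x $ i) = r"
    using y by (auto simp: vsphere_iff)
  then have "v ((A *v y) $ i - x $ i) = r"
    using val_add_eq[of "(A *v y) $ i - y $ i" "y $ i - x $ i"] close[of i] by simp
  ultimately show ?thesis
    unfolding vsphere_iff by blast
qed

end

section \<open>Assembling the paradoxes\<close>

lemma paradoxicalI:
  assumes "E \<noteq> {}" "E = A \<union> B" "A \<inter> B = {}" "1 \<le> m" "1 \<le> l"
    and "equidecomposable G \<phi> m A E" "equidecomposable G \<phi> l B E"
  shows "paradoxical G \<phi> E (m + l)"
  unfolding paradoxical_def using assms by blast

text \<open>\<open>A\<close> stays in place, and \<open>A'\<close> is moved onto everything
  else.\<close>

lemma equidecomposable_two_pieces:
  assumes "e \<in> carrier G" "\<phi> e = id" "g \<in> carrier G"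
    and "\<phi> g ` A' = X - A" "A \<inter> A' = {}" "A \<subseteq> X"
  shows "equidecomposable G \<phi> 2 (A \<union> A') X"
proof -
  have "equidecomposable G \<phi> 1 A A"
    using assms(1,2) by (intro equidecomposable_image[of e]) simp_all
  moreover have "equidecomposable G \<phi> 1 A' (X - A)"
    using assms(3,4) by (intro equidecomposable_image)
  ultimately have "equidecomposable G \<phi> (1 + 1) (A \<union> A') (A \<union> (X - A))"
    by (rule equidecomposable_Un) (use assms(5) in auto)
  moreover have "A \<union> (X - A) = X"
    using assms(6) by auto
  ultimately show ?thesis
    by (simp add: numeral_2_eq_2)
qed

lemma matrix_vector_mult_mat_1: "(*v) (mat 1 :: 'k::field ^ 'n ^ 'n) = id"
  by (simp add: fun_eq_iff)

context nonarch_field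
begin

text \<open>The letters come from a smaller congruence group that preserves the sphere. The scalar
  \<open>s\<close> is fixed before \<open>F\<close> and \<open>\<tau>\<close>, so one choice serves
  several pairings at once.\<close>

lemma vsphere_invariant_generators:
  fixes x :: "'k ^ 'n"
  assumes "nontrivial_valuation v" "0 < \<epsilon>" "\<epsilon> \<le> 1" "0 < r"
  obtains P N s where "sized_subring P N s"
    and "\<And>F \<tau> c. pairing F \<tau> \<Longrightarrow> letter_matrix F \<tau> s c \<in> carrier (SL_eps v (scalar_ring v) \<epsilon> :: ('k ^ 'n ^ 'n) monoid)"
    and "\<And>F \<tau> c y. pairing F \<tau> \<Longrightarrow> y \<in> vsphere v x r \<Longrightarrow> letter_matrix F \<tau> s c *v y \<in> vsphere v x r"
proof -
  let ?\<rho> = "max r (max_norm v x)"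
  define \<delta> where "\<delta> = min \<epsilon> (r / ?\<rho>)"
  have \<rho>: "0 < ?\<rho>"
    using assms(4) by (simp add: less_max_iff_disj)
  have \<delta>: "0 < \<delta>" "\<delta> \<le> \<epsilon>" "\<delta> \<le> 1"
    using assms(2-4) \<rho> by (simp_all add: \<delta>_def)
  have "\<delta> * ?\<rho> \<le> r / ?\<rho> * ?\<rho>"
    using \<rho> by (intro mult_right_mono) (simp_all add: \<delta>_def)
  then have \<delta>_r: "\<delta> * ?\<rho> \<le> r"
    using \<rho> by simp
  obtain P N s where s: "sized_subring P N s" "s \<in> scalar_ring v" "v s < \<delta>"
    using small_scalar[OF assms(1) \<delta>(1)] by blast
  have mem: "letter_matrix F \<tau> s c \<in> carrier (SL_eps v (scalar_ring v) \<delta> :: ('k ^ 'n ^ 'n) monoid)"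
    if "pairing F \<tau>" for F \<tau> c
    using that \<delta> s by (intro letter_matrix_in_SL_eps) auto
  show thesis
  proof (rule that[OF s(1)])
    show "letter_matrix F \<tau> s c \<in> carrier (SL_eps v (scalar_ring v) \<epsilon> :: ('k ^ 'n ^ 'n) monoid)"
      if "pairing F \<tau>" for F \<tau> c
      using mem[OF that] SL_eps_mono[OF \<delta>(2)] by blast
    show "letter_matrix F \<tau> s c *v y \<in> vsphere v x r"
      if "pairing F \<tau>" "y \<in> vsphere v x r" for F \<tau> c y
      using SL_eps_preserves_vsphere[OF mem[OF that(1)] assms(4) \<delta>_r that(2)] .
  qed
qed

lemma vsphere_nonempty:
  assumes "r \<in> value_group v"
  shows "vsphere v (x :: 'k ^ 'n) r \<noteq> {}"
proof -
  obtain a where a: "r = v a"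
    using assms by (auto simp: value_group_def)
  have "x + (\<chi> i. a) \<in> vsphere v x r"
    by (simp add: vsphere_iff a)
  then show ?thesis
    by blast
qed

lemma paradoxical_vsphere_four:
  fixes x :: "'k ^ 'n" and F :: "'n set"
  assumes "nontrivial_valuation v" "0 < \<epsilon>" "\<epsilon> \<le> 1" "r \<in> value_group v" "pairing F \<tau>"
    and nonzero: "\<And>y. y \<in> vsphere v x r \<Longrightarrow> \<exists>i\<in>F \<union> \<tau> ` F. y $ i \<noteq> 0"
  shows "paradoxical (SL_eps v (scalar_ring v) \<epsilon>) (*v) (vsphere v x r) 4"
proof -
  have "0 < r"
    using assms(4) by (auto simp: value_group_def less_le)
  let ?G = "SL_eps v (scalar_ring v) \<epsilon> :: ('k ^ 'n ^ 'n) monoid"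
  let ?S = "vsphere v x r"
  obtain P N s where sized: "sized_subring P N s"
    and mem: "\<And>F \<tau> c. pairing F \<tau> \<Longrightarrow> letter_matrix F \<tau> s c \<in> carrier ?G"
    and inv: "\<And>F \<tau> c y. pairing F \<tau> \<Longrightarrow> y \<in> ?S \<Longrightarrow> letter_matrix F \<tau> s c *v y \<in> ?S"
    by (rule vsphere_invariant_generators[where x = x, OF assms(1-3) \<open>0 < r\<close>]) blast
  have S_eq: "?S = {y \<in> ?S. \<exists>i\<in>F \<union> \<tau> ` F. y $ i \<noteq> 0}"
    using nonzero by blast
  have free: "free_action ?S (\<lambda>c y. letter_matrix F \<tau> s c *v y)"
    by (subst S_eq) (rule sized_subring.free_action_letter_matrix[OF sized assms(5) inv[OF assms(5)]])
  obtain A1 A2 A3 A4 where A: "(A1 \<union> A2) \<union> (A3 \<union> A4) = ?S" "(A1 \<union> A2) \<inter> (A3 \<union> A4) = {}"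
    "A1 \<inter> A2 = {}" "A3 \<inter> A4 = {}"
    "(*v) (letter_matrix F \<tau> s (True, True)) ` A2 = ?S - A1"
    "(*v) (letter_matrix F \<tau> s (False, True)) ` A4 = ?S - A3"
    by (rule free_action.four_piece_decomposition[OF free])
  note two_pieces = equidecomposable_two_pieces[where \<phi> = "(*v)" and e = "mat 1" and G = ?G,
      OF mat_1_in_SL_eps[OF assms(2)] matrix_vector_mult_mat_1]
  have "equidecomposable ?G (*v) 2 (A1 \<union> A2) ?S"
    by (rule two_pieces[OF mem[OF assms(5)] A(5,3)]) (use A(1) in blast)
  moreover have "equidecomposable ?G (*v) 2 (A3 \<union> A4) ?S"
    by (rule two_pieces[OF mem[OF assms(5)] A(6,4)]) (use A(1) in blast)
  ultimately have "paradoxical ?G (*v) ?S (2 + 2)"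
    using A(1,2) vsphere_nonempty[OF assms(4)] by (intro paradoxicalI[where A = "A1 \<union> A2" and B = "A3 \<union> A4"]) auto
  then show ?thesis
    by simp
qed

text \<open>Only one of the two halves \<open>A1 \<union> A2\<close>, \<open>A3 \<union> A4\<close> of the paradox for the free part has to
  absorb the axis, which doubles its number of pieces. The other half is enlarged by the axis itself.\<close>

lemma paradoxical_vsphere_six:
  fixes x :: "'k ^ 'n" and F :: "'n set"
  assumes "nontrivial_valuation v" "0 < \<epsilon>" "\<epsilon> \<le> 1" "r \<in> value_group v" "0 \<notin> vsphere v x r"
    and "pairing F \<tau>" "F \<union> \<tau> ` F = - {k}" "j \<noteq> k"
  shows "paradoxical (SL_eps v (scalar_ring v) \<epsilon>) (*v) (vsphere v x r) 6"
proof -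
  have "0 < r"
    using assms(4) by (auto simp: value_group_def less_le)
  let ?G = "SL_eps v (scalar_ring v) \<epsilon> :: ('k ^ 'n ^ 'n) monoid"
  let ?S = "vsphere v x r"
  obtain P N s where sized: "sized_subring P N s"
    and mem: "\<And>F \<tau> c. pairing F \<tau> \<Longrightarrow> letter_matrix F \<tau> s c \<in> carrier ?G"
    and inv: "\<And>F \<tau> c y. pairing F \<tau> \<Longrightarrow> y \<in> ?S \<Longrightarrow> letter_matrix F \<tau> s c *v y \<in> ?S"
    by (rule vsphere_invariant_generators[where x = x, OF assms(1-3) \<open>0 < r\<close>]) blast
  define X where "X = {y \<in> ?S. \<exists>i\<in>F \<union> \<tau> ` F. y $ i \<noteq> 0}"
  \<comment> \<open>In view of the assumption on \<open>F\<close>, these are the points of the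
    sphere on the axis of \<open>k\<close>.\<close>
  define B where "B = ?S - X"
  have XB: "X \<inter> B = {}" "X \<union> B = ?S"
    by (auto simp: X_def B_def)
  have one: "mat 1 \<in> carrier ?G"
    by (rule mat_1_in_SL_eps[OF assms(2)])
  note two_pieces = equidecomposable_two_pieces[where \<phi> = "(*v)" and e = "mat 1" and G = ?G,
      OF one matrix_vector_mult_mat_1]
  note absorb = equidecomposable_absorb[where \<phi> = "(*v)" and e = "mat 1" and G = ?G,
      OF one matrix_vector_mult_mat_1]
  have free: "free_action X (\<lambda>c y. letter_matrix F \<tau> s c *v y)"
    unfolding X_def by (rule sized_subring.free_action_letter_matrix[OF sized assms(6) inv[OF assms(6)]])
  obtain A1 A2 A3 A4 where A: "(A1 \<union> A2) \<union> (A3 \<union> A4) = X" "(A1 \<union> A2) \<inter> (A3 \<union> A4) = {}"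
    "A1 \<inter> A2 = {}" "A3 \<inter> A4 = {}"
    "(*v) (letter_matrix F \<tau> s (True, True)) ` A2 = X - A1"
    "(*v) (letter_matrix F \<tau> s (False, True)) ` A4 = X - A3"
    by (rule free_action.four_piece_decomposition[OF free])
  \<comment> \<open>A second pairing, of \<open>j\<close> with \<open>k\<close>: its generator
    pushes the axis of \<open>k\<close> off itself within that plane.\<close>
  let ?\<sigma> = "\<lambda>i. if i = j then k else j"
  let ?h = "letter_matrix {j} ?\<sigma> s (True, True) :: 'k ^ 'n ^ 'n"
  let ?h' = "letter_matrix {j} ?\<sigma> s (inv_letter (True, True)) :: 'k ^ 'n ^ 'n"
  have \<sigma>: "pairing {j} ?\<sigma>"
    using assms(8) by (simp add: pairing_def)
  have absorbed: "equidecomposable ?G (*v) 2 X (X \<union> B)"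
  proof (rule absorb[where g = ?h' and f = "(*v) ?h", OF mem[OF \<sigma>] XB(1)])
    show "?h *v y \<in> X \<union> B" if "y \<in> X \<union> B" for y
      using inv[OF \<sigma>] that unfolding XB(2) .
    show "?h' *v (?h *v y) = y" for y
      by (rule letter_matrix_inv_letter[OF \<sigma>])
    show "((*v) ?h ^^ Suc m) y \<notin> B" if "y \<in> B" for y m
    proof
      have pair: "((((*v) ?h ^^ m) y) $ j, (((*v) ?h ^^ m) y) $ k) = (pair_act s (True, True) ^^ m) (y $ j, y $ k)" for m
      proof (induction m)
        case (Suc m)
        then show ?case
          using letter_matrix_apply(1)[OF \<sigma>, of j s "(True, True)" "((*v) ?h ^^ m) y"] by simp
      qed simp
      have axis: "z $ i = 0" if "z \<in> B" "i \<noteq> k" for z i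
        using that assms(7) by (auto simp: B_def X_def)
      assume "((*v) ?h ^^ Suc m) y \<in> B"
      then have "((*v) ?h ^^ Suc m) y $ j = 0"
        using axis assms(8) by blast
      moreover have "y $ j = 0"
        using axis[OF \<open>y \<in> B\<close> assms(8)] .
      ultimately have "fst ((pair_act s (True, True) ^^ Suc m) (0, y $ k)) = 0"
        using arg_cong[OF pair[of "Suc m"], of fst] by (simp only: fst_conv)
      then have "y $ k = 0"
        using sized_subring.shears_power_moves_axis[OF sized] by blast
      \<comment> \<open>A return to the axis would make the remaining coordinate vanish as well, but
        the origin is not on the sphere.\<close>
      then have "y $ i = 0" for i
        using axis[OF \<open>y \<in> B\<close>] by (cases "i = k") simp_all
      then have "y = 0"
        by (simp add: vec_eq_iff)
      then show False
        using \<open>y \<in> B\<close> assms(5) by (simp add: B_def)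
    qed
  qed
  have "equidecomposable ?G (*v) 2 (A3 \<union> A4) X"
    by (rule two_pieces[OF mem[OF assms(6)] A(6,4)]) (use A(1) in blast)
  then have "equidecomposable ?G (*v) (2 * 2) (A3 \<union> A4) ?S"
  proof (rule equidecomposable_trans[OF _ absorbed[unfolded XB(2)]])
    fix g h :: "'k ^ 'n ^ 'n" assume gh: "g \<in> carrier ?G" "h \<in> carrier ?G"
    then show "g \<otimes>\<^bsub>?G\<^esub> h \<in> carrier ?G \<and> (*v) (g \<otimes>\<^bsub>?G\<^esub> h) = (*v) g \<circ> (*v) h"
      using SL_eps_mult[OF assms(3,2) gh] by (simp add: SL_eps_def fun_eq_iff matrix_vector_mul_assoc)
    have "det g \<noteq> 0"
      using gh(1) by (simp add: SL_eps_iff)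
    then show "inj ((*v) g)"
      by (simp add: inj_matrix_vector_mult invertible_det_nz)
  qed
  moreover have "equidecomposable ?G (*v) 2 ((A1 \<union> B) \<union> A2) ?S"
  proof (rule two_pieces[OF mem[OF assms(6)]])
    show "(*v) (letter_matrix F \<tau> s (True, True)) ` A2 = ?S - (A1 \<union> B)"
      using A(5) XB by blast
    show "(A1 \<union> B) \<inter> A2 = {}" "A1 \<union> B \<subseteq> ?S"
      using A(1,3) XB by blast+
  qed
  ultimately have "paradoxical ?G (*v) ?S (2 + 2 * 2)"
  proof (intro paradoxicalI[where A = "(A1 \<union> B) \<union> A2" and B = "A3 \<union> A4"])
    show "?S = A1 \<union> B \<union> A2 \<union> (A3 \<union> A4)" "(A1 \<union> B \<union> A2) \<inter> (A3 \<union> A4) = {}"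
      using A(1,2) XB by blast+
  qed (simp_all add: vsphere_nonempty[OF assms(4)])
  then show ?thesis
    by simp
qed

end

theorem theorem5p2:
  fixes v :: "'k::field \<Rightarrow> real" and \<epsilon> r :: real and x :: "'k ^ 'n"
  assumes "nonarch_valuation v"
    and "nontrivial_valuation v"
    and "0 < \<epsilon>" and "\<epsilon> \<le> 1"
    and "r \<in> value_group v"
    and "CARD('n) \<ge> 2"
    and "0 \<notin> vsphere v x r"
  shows "(max_norm v x > r \<longrightarrow>
           paradoxical (SL_eps v (scalar_ring v) \<epsilon>) (*v) (vsphere v x r) 4) \<and>
         (max_norm v x < r \<longrightarrow>
           paradoxical (SL_eps v (scalar_ring v) \<epsilon>) (*v) (vsphere v x r)
             (nat (5 - (-1) ^ CARD('n))))"
proof (intro conjI impI)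
  interpret nonarch_field v
    by unfold_locales (rule assms(1))
  have other: "\<exists>j. j \<noteq> i" for i :: 'n
  proof (rule ccontr)
    assume "\<nexists>j. j \<noteq> i"
    then have "(UNIV :: 'n set) = {i}"
      by auto
    then have "CARD('n) = 1"
      by (metis card_1_singleton_iff One_nat_def)
    then show False
      using assms(6) by simp
  qed
  show "paradoxical (SL_eps v (scalar_ring v) \<epsilon>) (*v) (vsphere v x r) 4" if "max_norm v x > r"
  proof -
    \<comment> \<open>At such a coordinate \<open>y $ i = 0\<close> would put \<open>x $ i\<close>
      within \<open>r\<close> of zero, so every point of the sphere is nonzero there. Any second
      index completes the plane.\<close>
    obtain i where i: "v (x $ i) = max_norm v x"
      using max_norm_attained by blast
    obtain j where "j \<noteq> i"
      using other by blast
    then have "pairing {i} (\<lambda>l. if l = i then j else i)"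
      by (simp add: pairing_def)
    moreover have "y $ i \<noteq> 0" if "y \<in> vsphere v x r" for y
    proof
      assume "y $ i = 0"
      then have "v (x $ i) \<le> r"
        using that val_minus_commute[of 0 "x $ i"] by (auto simp: vsphere_iff dest: spec[of _ i])
      then show False
        using i \<open>max_norm v x > r\<close> by simp
    qed
    ultimately show ?thesis
      by (intro paradoxical_vsphere_four[OF assms(2-5)]) auto
  qed
  show "paradoxical (SL_eps v (scalar_ring v) \<epsilon>) (*v) (vsphere v x r) (nat (5 - (-1) ^ CARD('n)))"
  proof (cases "even CARD('n)")
    case True
    obtain F :: "'n set" and \<tau> where F: "pairing F \<tau>" "F \<union> \<tau> ` F = UNIV"
      using even_set_pairing[OF finite True] by blast
    have "\<exists>i. y $ i \<noteq> 0" if "y \<in> vsphere v x r" for y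
    proof (rule ccontr)
      assume "\<nexists>i. y $ i \<noteq> 0"
      then have "y = 0"
        by (simp add: vec_eq_iff)
      then show False
        using that assms(7) by simp
    qed
    then have "paradoxical (SL_eps v (scalar_ring v) \<epsilon>) (*v) (vsphere v x r) 4"
      by (intro paradoxical_vsphere_four[OF assms(2-5) F(1)]) (simp add: F(2))
    then show ?thesis
      using True by simp
  next
    case False
    \<comment> \<open>Any index will do as the axis left out of the pairing.\<close>
    define k :: 'n where "k = undefined"
    have "even (card (- {k}))"
      using False by (simp add: Compl_eq_Diff_UNIV card_Diff_singleton)
    then obtain F \<tau> where F: "pairing F \<tau>" "F \<union> \<tau> ` F = - {k}"
      using even_set_pairing[of "- {k}"] finite[of "- {k}"] by blast
    obtain j where "j \<noteq> k"
      using other by blast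
    then have "paradoxical (SL_eps v (scalar_ring v) \<epsilon>) (*v) (vsphere v x r) 6"
      by (rule paradoxical_vsphere_six[OF assms(2-5,7) F])
    then show ?thesis
      using False by simp
  qed
qed

end
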